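(* Let $\hat s\in\mathrm{Dom}_{\mathcal S}(\hat T_b)$ and $\hat f\in\mathrm{Dom}_{\mathcal W}(\hat T_b)$ be such that $\|\hat f\|_{\mathcal W}=\|\hat s\|_{\mathcal S}=1$. Then: 1. The expected value of $\hat f\otimes\hat s$ with respect to $\breve T_b$ is $$e_{\hat f\otimes\hat s}(\breve T_b)=e^{\mathcal S}_{\hat s}\Big(i\frac{\partial}{\partial\omega}\Big)-e^{\mathcal W}_{\hat f}\Big(i\omega'\frac{\partial}{\partial\omega'}\Big)\,e^{\mathcal S}_{\hat s}\Big(\frac1\omega\Big).$$ 2. The variance of $\hat f\otimes\hat s$ with respect to $\breve T_b$ is $$v_{\hat f\otimes\hat s}(\breve T_b)=v^{\mathcal S}_{\hat s}\Big(i\frac{\partial}{\partial\omega}-e^{\mathcal W}_{\hat f}\Big(i\omega'\frac{\partial}{\partial\omega'}\Big)\frac1\omega\Big)+v^{\mathcal W}_{\hat f}\Big(i\omega'\frac{\partial}{\partial\omega'}\Big)\Big\|\frac1\omega\hat s\Big\|_{\mathcal S}^2.$$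
   Context: Spaces: $\mathcal S=L^2(\mathbb R,d\omega)$, $\mathcal W=L^2(\mathbb R,\frac{1}{|\omega'|}d\omega')$ (complex-valued functions), and the window-signal space $\mathcal W\otimes\mathcal S=L^2(\mathbb R^2;\frac{1}{|\omega'|}d\omega'd\omega)$, where $\omega'$ is the window variable and $\omega$ the signal variable. For $\hat f\in\mathcal W,\hat s\in\mathcal S$, the simple function is $(\hat f\otimes\hat s)(\omega',\omega)=\overline{\hat f(\omega')}\,\hat s(\omega)$. Inner products are linear in the first argument. Moments: $e_f(T)=\langle Tf,f\rangle$ and $v_f(T)=\|(T-e_f(T))f\|^2$; a superscript $\mathcal S$ or $\mathcal W$ indicates the space in which these are computed, and without superscript they are computed in $\mathcal W\otimes\mathcal S$. A function $q$ in place of an operator denotes multiplication by $q$; $q(x)\frac{\partial}{\partial x}$ denotes $f\mapsto qf'$. The operator $\breve T_b$ (the pull-back to $\mathcal W\otimes\mathcal S$ of multiplication by the time variable $b$ in the wavelet phase space) is $\breve T_bF=\big(i\frac{\partial}{\partial\omega}+i\frac{\omega'}{\omega}\frac{\partial}{\partial\omega'}\big)F$, on the domain of all $F\in\mathcal W\otimes\mathcal S$ such that, for almost every $\kappa\in\mathbb R$, the restriction of $F$ to every compact interval of the line $\{\omega'=\kappa\omega\}$ (parameterized by $\omega$) is absolutely continuous, and $\breve T_bF\in\mathcal W\otimes\mathcal S$. Here the differential expression is understood as $i$ times the derivative in $\omega$ along the lines $\omega'=\kappa\omega$. $\mathrm{Dom}_{\mathcal S}(\hat T_b)$ is the set of $\hat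 s\in L^2(\mathbb R)$ that are absolutely continuous on every compact interval with $\hat s'\in L^2(\mathbb R)$ and $\frac1\omega\hat s\in L^2(\mathbb R)$. $\mathrm{Dom}_{\mathcal W}(\hat T_b)$ is the set of $\hat f\in\mathcal W$ that are absolutely continuous on every compact interval with $\omega'\hat f'(\omega')\in\mathcal W$. *)

theory Defs
  imports "HOL-Analysis.Analysis"
begin

text \<open>
  Elements of an $L^2$ space are represented by functions. Wherever derivatives occur, the
  representative is the absolutely continuous one. All base measures are completed (Lebesgue)
  measures, so that modifying a function on a null set preserves measurability.
\<close>

definition L2 :: "'a measure \<Rightarrow> ('a \<Rightarrow> complex) set" where
  "L2 M = {f \<in> borel_measurable M. integrable M (\<lambda>x. (cmod (f x))\<^sup>2)}"

definition L2_inner :: "'a measure \<Rightarrow> ('a \<Rightarrow> complex) \<Rightarrow> ('a \<Rightarrow> complex) \<Rightarrow> complex" where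
  "L2_inner M f g = (\<integral>x. f x * cnj (g x) \<partial>M)"

definition L2_norm :: "'a measure \<Rightarrow> ('a \<Rightarrow> complex) \<Rightarrow> real" where
  "L2_norm M f = sqrt (\<integral>x. (cmod (f x))\<^sup>2 \<partial>M)"

definition signal_space :: "real measure" where
  "signal_space = lebesgue"

text \<open>In the two weighted measures the value \<open>1 / \<bar>0\<bar> = 0\<close> is only used on a null set.\<close>

definition window_space :: "real measure" where
  "window_space = density lebesgue (\<lambda>\<omega>'. ennreal (1 / \<bar>\<omega>'\<bar>))"

text \<open>The first coordinate is the window variable, the second one the signal variable.\<close>

definition window_signal_space :: "(real \<times> real) measure" where
  "window_signal_space = density lebesgue (\<lambda>(\<omega>', \<omega>). ennreal (1 / \<bar>\<omega>'\<bar>))"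

definition simple_fun :: "(real \<Rightarrow> complex) \<Rightarrow> (real \<Rightarrow> complex) \<Rightarrow> real \<times> real \<Rightarrow> complex" where
  "simple_fun f s = (\<lambda>(\<omega>', \<omega>). cnj (f \<omega>') * s \<omega>)"

definition op_mean :: "'a measure \<Rightarrow> (('a \<Rightarrow> complex) \<Rightarrow> 'a \<Rightarrow> complex) \<Rightarrow> ('a \<Rightarrow> complex) \<Rightarrow> complex" where
  "op_mean M T f = L2_inner M (T f) f"

definition op_variance :: "'a measure \<Rightarrow> (('a \<Rightarrow> complex) \<Rightarrow> 'a \<Rightarrow> complex) \<Rightarrow> ('a \<Rightarrow> complex) \<Rightarrow> real" where
  "op_variance M T f = (L2_norm M (\<lambda>x. T f x - op_mean M T f * f x))\<^sup>2"

definition mult_op :: "('a \<Rightarrow> complex) \<Rightarrow> ('a \<Rightarrow> complex) \<Rightarrow> 'a \<Rightarrow> complex" where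
  "mult_op q f = (\<lambda>x. q x * f x)"

text \<open>
  At points of non-differentiability \<open>vector_derivative\<close> has an unspecified value; for an absolutely
  continuous function these points form a null set.
\<close>

definition diff_op :: "(real \<Rightarrow> complex) \<Rightarrow> (real \<Rightarrow> complex) \<Rightarrow> real \<Rightarrow> complex" where
  "diff_op q f = (\<lambda>x. q x * vector_derivative f (at x))"

text \<open>
  The usual \<open>\<epsilon>\<close>-\<open>\<delta>\<close> definition: \<open>d\<close> ranges over the finite families of
  non-overlapping compact intervals contained in \<open>S\<close>, and \<open>Inf k\<close>, \<open>Sup k\<close> are the endpoints of \<open>k\<close>.
\<close>

definition abs_continuous_on :: "real set \<Rightarrow> (real \<Rightarrow> complex) \<Rightarrow> bool" where
  "abs_continuous_on S f \<longleftrightarrow>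
    (\<forall>\<epsilon>>0. \<exists>\<delta>>0. \<forall>d. d division_of \<Union>d \<longrightarrow> \<Union>d \<subseteq> S \<longrightarrow> (\<Sum>k\<in>d. Sup k - Inf k) < \<delta> \<longrightarrow>
      (\<Sum>k\<in>d. cmod (f (Sup k) - f (Inf k))) < \<epsilon>)"

definition locally_abs_continuous :: "(real \<Rightarrow> complex) \<Rightarrow> bool" where
  "locally_abs_continuous f \<longleftrightarrow> (\<forall>a b. abs_continuous_on {a..b} f)"

definition Dom_S :: "(real \<Rightarrow> complex) set" where
  "Dom_S = {s \<in> L2 signal_space. locally_abs_continuous s \<and>
      diff_op (\<lambda>_. 1) s \<in> L2 signal_space \<and>
      mult_op (\<lambda>\<omega>. 1 / of_real \<omega>) s \<in> L2 signal_space}"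

definition Dom_W :: "(real \<Rightarrow> complex) set" where
  "Dom_W = {f \<in> L2 window_space. locally_abs_continuous f \<and>
      diff_op (\<lambda>\<omega>'. of_real \<omega>') f \<in> L2 window_space}"

text \<open>
  \<open>\<i> \<partial>/\<partial>\<omega> + \<i> (\<omega>'/\<omega>) \<partial>/\<partial>\<omega>'\<close>, read as \<open>\<i>\<close> times the derivative in \<open>\<omega>\<close> along the line through the origin
  with slope \<open>\<kappa> = \<omega>'/\<omega>\<close>. The points with \<open>\<omega> = 0\<close>, which lie on no such line except for the
  origin, form a null set.
\<close>

definition breve_T :: "(real \<times> real \<Rightarrow> complex) \<Rightarrow> real \<times> real \<Rightarrow> complex" where
  "breve_T F = (\<lambda>(\<omega>', \<omega>). \<i> * vector_derivative (\<lambda>t. F ((\<omega>' / \<omega>) * t, t)) (at \<omega>))"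

definition Dom_breve_T :: "(real \<times> real \<Rightarrow> complex) set" where
  "Dom_breve_T = {F \<in> L2 window_signal_space.
      (AE \<kappa> in lebesgue. locally_abs_continuous (\<lambda>t. F (\<kappa> * t, t))) \<and>
      breve_T F \<in> L2 window_signal_space}"

end

theory Submission
  imports Defs
begin

text \<open>
  Almost everywhere, \<open>breve_T (f \<otimes> s) = f \<otimes> \<i>s' - \<i>\<omega>'f' \<otimes> s/\<omega>\<close>, by the product and chain rules; this
  needs Lebesgue's theorem that absolutely continuous functions are differentiable almost
  everywhere. The mean formula then follows from the factorisation of inner products of simple
  functions, once it is known that the mean \<open>e\<close> of \<open>\<i>\<omega>'\<partial>/\<partial>\<omega>'\<close> at \<open>f\<close> is real, which is an integration
  by parts. For the variance, centring splits \<open>breve_T (f \<otimes> s)\<close> minus its mean into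
  \<open>f \<otimes> X - Y \<otimes> s/\<omega>\<close> with \<open>Y = \<i>\<omega>'f' - e f\<close>, and the two parts are orthogonal because \<open>Y\<close> is
  orthogonal to \<open>f\<close>.
\<close>

section \<open>Absolute continuity\<close>

text \<open>The conjugate on the window factor of a simple function is what makes the reality of
  \<open>e\<close> indispensable: taking inner products exchanges the window arguments, so the mean
  produces the conjugate of \<open>e\<close>, and the centred window part produces it again in the
  variance. Absolute continuity speaks about finite families of intervals. Differentiability is
  therefore studied through quotients over intervals with \<open>u < x < v\<close> rather than
  through one-sided quotients at \<open>x\<close>: the points lying in some such interval form an
  open set whatever else is required of the interval, so the exceptional sets are measurable, and
  the same intervals form Vitali covers. Integrating by parts then uses a fundamental theorem for
  the gauge integral. On the plane two kinds of null sets interfere: \<open>breve_T\<close> is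
  controlled only almost everywhere, which completeness of Lebesgue measure absorbs, while Fubini's
  theorem is applied to Borel representatives.\<close>

lemma division_member_endpoints:
  fixes k :: "real set"
  assumes "d division_of S" "k \<in> d"
  shows "k = {Inf k..Sup k}" "Inf k \<le> Sup k" "Inf k \<in> S" "Sup k \<in> S" "k \<subseteq> S"
proof -
  obtain u v where k: "k = {u..v}" using division_ofD(4)[OF assms] by auto
  moreover have "k \<noteq> {}" "k \<subseteq> S" using division_ofD(2,3)[OF assms] by auto
  ultimately show "k = {Inf k..Sup k}" "Inf k \<le> Sup k" "Inf k \<in> S" "Sup k \<in> S" "k \<subseteq> S"
    by auto
qed

lemma abs_continuous_onE:
  assumes "abs_continuous_on S f" "\<epsilon> > 0"
  obtains \<delta> where "\<delta> > 0" "\<And>d. d division_of \<Union>d \<Longrightarrow> \<Union>d \<subseteq> S \<Longrightarrow>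
      (\<Sum>k\<in>d. Sup k - Inf k) < \<delta> \<Longrightarrow> (\<Sum>k\<in>d. cmod (f (Sup k) - f (Inf k))) < \<epsilon>"
proof -
  have "\<exists>\<delta>>0. \<forall>d. d division_of \<Union>d \<longrightarrow> \<Union>d \<subseteq> S \<longrightarrow> (\<Sum>k\<in>d. Sup k - Inf k) < \<delta> \<longrightarrow>
      (\<Sum>k\<in>d. cmod (f (Sup k) - f (Inf k))) < \<epsilon>"
    using assms unfolding abs_continuous_on_def by simp
  then show ?thesis using that by (elim exE conjE) simp
qed

text \<open>Conjugates, real and imaginary parts and negatives of an absolutely continuous function
  are all handled by this comparison of increments.\<close>

lemma abs_continuous_on_dominated:
  assumes f: "abs_continuous_on S f"
    and le: "\<And>x y. x \<in> S \<Longrightarrow> y \<in> S \<Longrightarrow> cmod (g y - g x) \<le> cmod (f y - f x)"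
  shows "abs_continuous_on S g"
  unfolding abs_continuous_on_def
proof (intro allI impI)
  fix \<epsilon> :: real assume "\<epsilon> > 0"
  then obtain \<delta> where \<delta>: "\<delta> > 0" "\<And>d. d division_of \<Union>d \<Longrightarrow> \<Union>d \<subseteq> S \<Longrightarrow>
      (\<Sum>k\<in>d. Sup k - Inf k) < \<delta> \<Longrightarrow> (\<Sum>k\<in>d. cmod (f (Sup k) - f (Inf k))) < \<epsilon>"
    using abs_continuous_onE[OF f] by blast
  have "(\<Sum>k\<in>d. cmod (g (Sup k) - g (Inf k))) < \<epsilon>"
    if d: "d division_of \<Union>d" "\<Union>d \<subseteq> S" "(\<Sum>k\<in>d. Sup k - Inf k) < \<delta>" for d
  proof (rule le_less_trans[OF sum_mono \<delta>(2)[OF d]])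
    fix k assume "k \<in> d"
    then show "cmod (g (Sup k) - g (Inf k)) \<le> cmod (f (Sup k) - f (Inf k))"
      using division_member_endpoints(3,4)[OF d(1)] d(2) by (intro le) auto
  qed
  with \<delta>(1) show "\<exists>\<delta>>0. \<forall>d. d division_of \<Union>d \<longrightarrow> \<Union>d \<subseteq> S \<longrightarrow> (\<Sum>k\<in>d. Sup k - Inf k) < \<delta> \<longrightarrow>
      (\<Sum>k\<in>d. cmod (g (Sup k) - g (Inf k))) < \<epsilon>" by blast
qed

lemma abs_continuous_on_increment:
  assumes f: "abs_continuous_on {a..b} f" and "\<epsilon> > 0"
  obtains \<delta> where "\<delta> > 0"
    "\<And>u v. a \<le> u \<Longrightarrow> u \<le> v \<Longrightarrow> v \<le> b \<Longrightarrow> v - u < \<delta> \<Longrightarrow> cmod (f v - f u) < \<epsilon>"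
proof -
  from assms obtain \<delta> where \<delta>: "\<delta> > 0" "\<And>d. d division_of \<Union>d \<Longrightarrow> \<Union>d \<subseteq> {a..b} \<Longrightarrow>
      (\<Sum>k\<in>d. Sup k - Inf k) < \<delta> \<Longrightarrow> (\<Sum>k\<in>d. cmod (f (Sup k) - f (Inf k))) < \<epsilon>"
    by (rule abs_continuous_onE) (rule that)
  have "cmod (f v - f u) < \<epsilon>" if "a \<le> u" "u \<le> v" "v \<le> b" "v - u < \<delta>" for u v
    using \<delta>(2)[of "{{u..v}}"] that division_of_self[of u v] by auto
  with \<delta>(1) show ?thesis by (rule that)
qed

lemma abs_continuous_on_imp_continuous_on:
  assumes f: "abs_continuous_on {a..b} f"
  shows "continuous_on {a..b} f"
  unfolding continuous_on_iff
proof (intro ballI allI impI)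
  fix x and e :: real assume x: "x \<in> {a..b}" and "e > 0"
  then obtain \<delta> where \<delta>: "\<delta> > 0"
    "\<And>u v. a \<le> u \<Longrightarrow> u \<le> v \<Longrightarrow> v \<le> b \<Longrightarrow> v - u < \<delta> \<Longrightarrow> cmod (f v - f u) < e"
    using abs_continuous_on_increment[OF f \<open>e > 0\<close>] by blast
  have "dist (f y) (f x) < e" if "y \<in> {a..b}" "dist y x < \<delta>" for y
    using \<delta>(2)[of x y] \<delta>(2)[of y x] that x
    by (cases "x \<le> y") (auto simp: dist_norm norm_minus_commute)
  with \<delta>(1) show "\<exists>d>0. \<forall>y\<in>{a..b}. dist y x < d \<longrightarrow> dist (f y) (f x) < e" by blast
qed

lemma abs_continuous_on_mult:
  assumes f: "abs_continuous_on {a..b} f" and g: "abs_continuous_on {a..b} g"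
  shows "abs_continuous_on {a..b} (\<lambda>x. f x * g x)"
  unfolding abs_continuous_on_def
proof (intro allI impI)
  fix \<epsilon> :: real assume "\<epsilon> > 0"
  have bdd: "\<exists>B>0. \<forall>x\<in>{a..b}. cmod (h x) \<le> B" if "abs_continuous_on {a..b} h" for h
  proof -
    have "bounded (h ` {a..b})"
      by (intro compact_imp_bounded compact_continuous_image
          abs_continuous_on_imp_continuous_on that compact_Icc)
    then show ?thesis unfolding bounded_pos by auto
  qed
  obtain B where B: "B > 0" "\<And>x. x \<in> {a..b} \<Longrightarrow> cmod (f x) \<le> B" using bdd[OF f] by blast
  obtain C where C: "C > 0" "\<And>x. x \<in> {a..b} \<Longrightarrow> cmod (g x) \<le> C" using bdd[OF g] by blast
  \<comment> \<open>An increment of the product splits into an increment of \<open>f\<close>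
    weighted by a value of \<open>g\<close> and one of \<open>g\<close> weighted by a value of
    \<open>f\<close>. Dividing by the bounds \<open>C\<close> and \<open>B\<close> of the weights
    leaves \<epsilon>/2 for each part.\<close>
  have eC: "\<epsilon> / 2 / C > 0" and eB: "\<epsilon> / 2 / B > 0" using \<open>\<epsilon> > 0\<close> \<open>B > 0\<close> \<open>C > 0\<close> by auto
  obtain \<delta> where \<delta>: "\<delta> > 0" "\<And>d. d division_of \<Union>d \<Longrightarrow> \<Union>d \<subseteq> {a..b} \<Longrightarrow>
      (\<Sum>k\<in>d. Sup k - Inf k) < \<delta> \<Longrightarrow> (\<Sum>k\<in>d. cmod (f (Sup k) - f (Inf k))) < \<epsilon> / 2 / C"
    using abs_continuous_onE[OF f eC] by blast
  obtain \<delta>' where \<delta>': "\<delta>' > 0" "\<And>d. d division_of \<Union>d \<Longrightarrow> \<Union>d \<subseteq> {a..b} \<Longrightarrow>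
      (\<Sum>k\<in>d. Sup k - Inf k) < \<delta>' \<Longrightarrow> (\<Sum>k\<in>d. cmod (g (Sup k) - g (Inf k))) < \<epsilon> / 2 / B"
    using abs_continuous_onE[OF g eB] by blast
  have "(\<Sum>k\<in>d. cmod (f (Sup k) * g (Sup k) - f (Inf k) * g (Inf k))) < \<epsilon>"
    if d: "d division_of \<Union>d" "\<Union>d \<subseteq> {a..b}" "(\<Sum>k\<in>d. Sup k - Inf k) < min \<delta> \<delta>'" for d
  proof -
    have "(\<Sum>k\<in>d. cmod (f (Sup k) * g (Sup k) - f (Inf k) * g (Inf k))) \<le>
        (\<Sum>k\<in>d. C * cmod (f (Sup k) - f (Inf k)) + B * cmod (g (Sup k) - g (Inf k)))"
    proof (rule sum_mono)
      fix k assume "k \<in> d"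
      then have k: "Inf k \<in> {a..b}" "Sup k \<in> {a..b}"
        using division_member_endpoints(3,4)[OF d(1) \<open>k \<in> d\<close>] d(2) by blast+
      have "f (Sup k) * g (Sup k) - f (Inf k) * g (Inf k)
          = g (Sup k) * (f (Sup k) - f (Inf k)) + f (Inf k) * (g (Sup k) - g (Inf k))"
        by (simp add: algebra_simps)
      also have "cmod \<dots> \<le> cmod (g (Sup k)) * cmod (f (Sup k) - f (Inf k))
          + cmod (f (Inf k)) * cmod (g (Sup k) - g (Inf k))"
        by (metis norm_mult norm_triangle_ineq)
      also have "\<dots> \<le> C * cmod (f (Sup k) - f (Inf k)) + B * cmod (g (Sup k) - g (Inf k))"
        by (intro add_mono mult_right_mono B C k) auto
      finally show "cmod (f (Sup k) * g (Sup k) - f (Inf k) * g (Inf k))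
          \<le> C * cmod (f (Sup k) - f (Inf k)) + B * cmod (g (Sup k) - g (Inf k))" .
    qed
    also have "\<dots> = C * (\<Sum>k\<in>d. cmod (f (Sup k) - f (Inf k)))
        + B * (\<Sum>k\<in>d. cmod (g (Sup k) - g (Inf k)))"
      by (simp add: sum.distrib sum_distrib_left)
    also have "\<dots> < C * (\<epsilon> / 2 / C) + B * (\<epsilon> / 2 / B)"
      using d B C by (intro add_strict_mono mult_strict_left_mono \<delta>(2) \<delta>'(2)) auto
    also have "\<dots> = \<epsilon>" using B C by simp
    finally show ?thesis .
  qed
  moreover have "min \<delta> \<delta>' > 0" using \<delta> \<delta>' by simp
  ultimately show "\<exists>\<delta>>0. \<forall>d. d division_of \<Union>d \<longrightarrow> \<Union>d \<subseteq> {a..b} \<longrightarrow> (\<Sum>k\<in>d. Sup k - Inf k) < \<delta> \<longrightarrow>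
      (\<Sum>k\<in>d. cmod (f (Sup k) * g (Sup k) - f (Inf k) * g (Inf k))) < \<epsilon>" by blast
qed

text \<open>A dilation by \<open>c\<close> is a linear bijection, hence respects interiors, and it
  maps intervals to intervals for either sign of \<open>c\<close>.\<close>

lemma division_of_scale:
  fixes c :: real
  assumes d: "d division_of \<Union>d" and "c \<noteq> 0"
  shows "((`) ((*) c) ` d) division_of \<Union>((`) ((*) c) ` d)"
proof (rule division_ofI)
  show "finite ((`) ((*) c) ` d)" using d by auto
  fix K assume "K \<in> (`) ((*) c) ` d"
  then obtain k where k: "k \<in> d" "K = (*) c ` k" by auto
  show "K \<noteq> {}" using division_ofD(3)[OF d k(1)] k by auto
  obtain u v where "k = cbox u v" using division_ofD(4)[OF d k(1)] by auto
  then show "\<exists>a b. K = cbox a b"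
    using image_smult_cbox[of c u v] k(2) by auto
  fix L assume "L \<in> (`) ((*) c) ` d" "K \<noteq> L"
  then obtain l where l: "l \<in> d" "L = (*) c ` l" "l \<noteq> k" using k by auto
  have "interior K \<inter> interior L = (*) c ` (interior k \<inter> interior l)"
    using \<open>c \<noteq> 0\<close> k l
    by (subst image_Int)
      (auto simp: inj_on_def interior_injective_linear_image[of "(*) c"] linear_times)
  then show "interior K \<inter> interior L = {}"
    using division_ofD(5)[OF d k(1) l(1)] l by auto
qed auto

text \<open>Restricting the window factor of a simple function to a line through the origin amounts
  to such a dilation. For \<open>c = 0\<close> the result is constant; otherwise divisions are
  pushed forward under multiplication by \<open>c\<close>, which multiplies their total length by
  \<open>\<bar>c\<bar>\<close>.\<close>

lemma locally_abs_continuous_scale: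
  assumes f: "locally_abs_continuous f"
  shows "locally_abs_continuous (\<lambda>t. f (c * t))"
  unfolding locally_abs_continuous_def
proof (intro allI)
  fix a b
  show "abs_continuous_on {a..b} (\<lambda>t. f (c * t))"
  proof (cases "c = 0")
    case True
    then show ?thesis unfolding abs_continuous_on_def
      by (auto intro!: exI[of _ 1])
  next
    case c: False
    define S where "S = {min (c * a) (c * b)..max (c * a) (c * b)}"
    have S: "c * x \<in> S" if "x \<in> {a..b}" for x
      using that c mult_left_mono[of a x c] mult_left_mono[of x b c]
        mult_left_mono_neg[of a x c] mult_left_mono_neg[of x b c]
      unfolding S_def by (cases "c > 0") (auto simp: min_def max_def)
    show ?thesis
      unfolding abs_continuous_on_def
    proof (intro allI impI)
      fix \<epsilon> :: real assume "\<epsilon> > 0"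
      have "abs_continuous_on S f"
        using f unfolding locally_abs_continuous_def S_def by blast
      then obtain \<delta> where \<delta>: "\<delta> > 0" "\<And>d. d division_of \<Union>d \<Longrightarrow> \<Union>d \<subseteq> S \<Longrightarrow>
          (\<Sum>k\<in>d. Sup k - Inf k) < \<delta> \<Longrightarrow> (\<Sum>k\<in>d. cmod (f (Sup k) - f (Inf k))) < \<epsilon>"
        using \<open>\<epsilon> > 0\<close> by (rule abs_continuous_onE) (rule that)
      have "(\<Sum>k\<in>d. cmod (f (c * Sup k) - f (c * Inf k))) < \<epsilon>"
        if d: "d division_of \<Union>d" "\<Union>d \<subseteq> {a..b}" "(\<Sum>k\<in>d. Sup k - Inf k) < \<delta> / \<bar>c\<bar>" for d
      proof -
        let ?d = "(`) ((*) c) ` d"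
        have inj: "inj_on ((`) ((*) c)) d"
          using c by (intro inj_onI) (auto simp: inj_image_eq_iff inj_on_def)
        \<comment> \<open>A negative factor exchanges the end points, which the modulus of an
          increment does not notice.\<close>
        have ends: "Inf ((*) c ` k) = (if c > 0 then c * Inf k else c * Sup k) \<and>
            Sup ((*) c ` k) = (if c > 0 then c * Sup k else c * Inf k)" if "k \<in> d" for k
        proof -
          define u v where "u = Inf k" and "v = Sup k"
          have k: "k = {u..v}" "u \<le> v"
            using division_member_endpoints[OF d(1) that] unfolding u_def v_def by auto
          show ?thesis
            using k image_mult_atLeastAtMost_if[of c u v] c mult_left_mono[of u v c]
              mult_left_mono_neg[of u v c]
            by (auto simp flip: u_def v_def)
        qed
        have "(\<Sum>k\<in>?d. Sup k - Inf k) = (\<Sum>k\<in>d. \<bar>c\<bar> * (Sup k - Inf k))"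
          unfolding sum.reindex[OF inj] o_def
          by (intro sum.cong) (auto simp: ends right_diff_distrib)
        also have "\<dots> < \<delta>"
          using d(3) c by (simp add: sum_distrib_left[symmetric] pos_less_divide_eq mult.commute)
        finally have "(\<Sum>k\<in>?d. cmod (f (Sup k) - f (Inf k))) < \<epsilon>"
          using d(2) S by (intro \<delta>(2) division_of_scale d(1) c) auto
        also have "(\<Sum>k\<in>?d. cmod (f (Sup k) - f (Inf k)))
            = (\<Sum>k\<in>d. cmod (f (c * Sup k) - f (c * Inf k)))"
          unfolding sum.reindex[OF inj] o_def
          by (intro sum.cong) (auto simp: ends norm_minus_commute)
        finally show ?thesis .
      qed
      moreover have "\<delta> / \<bar>c\<bar> > 0" using \<delta> c by simp
      ultimately show "\<exists>\<delta>>0. \<forall>d. d division_of \<Union>d \<longrightarrow> \<Union>d \<subseteq> {a..b} \<longrightarrow>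
          (\<Sum>k\<in>d. Sup k - Inf k) < \<delta> \<longrightarrow> (\<Sum>k\<in>d. cmod (f (c * Sup k) - f (c * Inf k))) < \<epsilon>"
        by blast
    qed
  qed
qed

lemma locally_abs_continuous_mult:
  "locally_abs_continuous f \<Longrightarrow> locally_abs_continuous g \<Longrightarrow> locally_abs_continuous (\<lambda>x. f x * g x)"
  unfolding locally_abs_continuous_def by (blast intro: abs_continuous_on_mult)

lemma locally_abs_continuous_cnj:
  "locally_abs_continuous f \<Longrightarrow> locally_abs_continuous (\<lambda>x. cnj (f x))"
  unfolding locally_abs_continuous_def
  by (auto intro!: abs_continuous_on_dominated[of _ f "\<lambda>x. cnj (f x)"] simp flip: complex_cnj_diff)

section \<open>Increments and lengths summed over divisions\<close>

text \<open>The sum telescopes. Tagging each interval with its left end point makes the additivity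
  theorem for tagged divisions applicable; any other choice of tags would do.\<close>

lemma sum_increments_division:
  fixes F :: "real \<Rightarrow> 'a::real_normed_vector"
  assumes d: "d division_of {a..b}" and "a \<le> b"
  shows "(\<Sum>k\<in>d. F (Sup k) - F (Inf k)) = F b - F a"
proof -
  have inj: "inj_on (\<lambda>k. (Inf k, k)) d" by (auto intro: inj_onI)
  have "(\<lambda>k. (Inf k, k)) ` d tagged_division_of {a..b}"
    unfolding tagged_division_of
    using division_ofD[OF d] division_member_endpoints[OF d] by (auto simp: image_iff) fastforce+
  from additive_tagged_division_1[OF \<open>a \<le> b\<close> this, of F] show ?thesis
    by (simp add: sum.reindex[OF inj])
qed

text \<open>Members of a division overlap in null sets only. This turns the length sums in the
  definition of absolute continuity into Lebesgue measure, which is how covering arguments reach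
  that definition.\<close>

lemma sum_lengths_division:
  fixes d :: "real set set"
  assumes d: "d division_of S"
  shows "(\<Sum>k\<in>d. Sup k - Inf k) = measure lebesgue S" "S \<in> lmeasurable"
proof -
  have "((\<lambda>x. 1::real) has_integral (Sup k - Inf k)) k" if "k \<in> d" for k
  proof -
    define u v where "u = Inf k" and "v = Sup k"
    have "k = {u..v}" "u \<le> v"
      using division_member_endpoints[OF d that] unfolding u_def v_def by auto
    then show ?thesis
      using has_integral_const_real[of "1::real" u v] by simp
  qed
  then have "((\<lambda>x. 1::real) has_integral (\<Sum>k\<in>d. Sup k - Inf k)) S"
    by (intro has_integral_combine_division d)
  moreover show *: "S \<in> lmeasurable"
    using d lmeasurable_division by blast
  ultimately show "(\<Sum>k\<in>d. Sup k - Inf k) = measure lebesgue S"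
    by (metis lmeasure_integral integral_unique)
qed

section \<open>Differentiability almost everywhere\<close>

text \<open>Vitali's theorem yields a countable disjoint subfamily covering \<open>S\<close> up to a
  null set; by continuity of the measure, finitely many members already cover all of
  \<open>S\<close> but a part of measure below \<open>e\<close>. The intervals may stick out of
  \<open>S\<close>; further constraints on them are imposed through \<open>K\<close>.\<close>

lemma Vitali_finite_intervals:
  fixes S :: "real set" and K :: "(real \<times> real) set"
  assumes S: "S \<in> lmeasurable" and "e > 0"
    and K: "\<And>x d. x \<in> S \<Longrightarrow> 0 < d \<Longrightarrow> \<exists>u v. (u, v) \<in> K \<and> u < x \<and> x < v \<and> v - u < d"
  obtains D where "D division_of \<Union>D" "pairwise disjnt D"
    "\<And>k. k \<in> D \<Longrightarrow> \<exists>u v. (u, v) \<in> K \<and> u < v \<and> k = {u..v}"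
    "measure lebesgue S - e < (\<Sum>k\<in>D. Sup k - Inf k)"
proof -
  \<comment> \<open>Discarding degenerate pairs makes every radius positive; the interval is the
    closed ball around its midpoint.\<close>
  define K' where "K' = {(u, v) \<in> K. u < v}"
  define I where "I = (\<lambda>(u, v). {u..v::real})"
  define m r where "m = (\<lambda>(u, v). (u + v) / 2 :: real)" and "r = (\<lambda>(u, v). (v - u) / 2 :: real)"
  have cb: "cball (m i) (r i) = I i" for i
    by (cases i) (auto simp: cball_eq_atLeastAtMost m_def r_def I_def field_simps)
  obtain C where C: "countable C" "C \<subseteq> K'"
      "pairwise (\<lambda>i j. disjnt (cball (m i) (r i)) (cball (m j) (r j))) C"
      "negligible (S - (\<Union>i\<in>C. cball (m i) (r i)))"
  proof (rule Vitali_covering_theorem_cballs)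
    show "0 < r i" if "i \<in> K'" for i
      using that by (auto simp: K'_def r_def)
    show "\<exists>i. i \<in> K' \<and> x \<in> cball (m i) (r i) \<and> r i < d" if x: "x \<in> S" "0 < d" for x d
    proof -
      obtain u v where "(u, v) \<in> K" "u < x" "x < v" "v - u < d" using K[OF x] by blast
      then show ?thesis unfolding cb
        by (intro exI[of _ "(u, v)"]) (auto simp: K'_def I_def r_def)
    qed
  qed
  show thesis
  proof (cases "C = {}")
    case True
    then have "measure lebesgue S = 0" using C(4) by (simp add: negligible_imp_measure0)
    then show ?thesis using \<open>e > 0\<close> by (intro that[of "{}"]) auto
  next
    case False
    define g where "g = from_nat_into C"
    have g: "range g = C" unfolding g_def using range_from_nat_into[OF False C(1)] .
    \<comment> \<open>The part of \<open>S\<close> covered by the first \<open>n\<close> intervals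
      of the enumeration; these sets increase to \<open>S\<close> up to a null set.\<close>
    define A where "A = (\<lambda>n. S \<inter> (\<Union>i<n. I (g i)))"
    have Imeas: "I i \<in> sets lebesgue" for i by (cases i) (auto simp: I_def)
    have Ameas: "A n \<in> sets lebesgue" for n
      using fmeasurableD[OF S] unfolding A_def by (rule sets.Int) (simp add: Imeas sets.finite_UN)
    have sub: "S - (\<Union>i. A i) \<subseteq> S - (\<Union>i\<in>C. cball (m i) (r i))"
      unfolding A_def cb g[symmetric] by auto
    have "(\<lambda>n. measure lebesgue (A n)) \<longlonglongrightarrow> measure lebesgue (\<Union>i. A i)"
    proof (rule Lim_measure_incseq)
      show "range A \<subseteq> sets lebesgue" using Ameas by blast
      show "incseq A" unfolding A_def incseq_def by (auto intro: order.strict_trans2)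
      have "emeasure lebesgue (\<Union>i. A i) \<le> emeasure lebesgue S"
        using fmeasurableD[OF S] by (intro emeasure_mono) (auto simp: A_def)
      then show "emeasure lebesgue (\<Union>i. A i) \<noteq> \<infinity>"
        using S by (auto simp: fmeasurable_def less_top[symmetric] top_unique)
    qed
    moreover have "measure lebesgue (\<Union>i. A i) = measure lebesgue S"
    proof (rule measure_negligible_symdiff[OF S])
      have "S - (\<Union>i. A i) \<union> ((\<Union>i. A i) - S) = S - (\<Union>i. A i)"
        by (auto simp: A_def)
      then show "negligible (S - (\<Union>i. A i) \<union> ((\<Union>i. A i) - S))"
        using negligible_subset[OF C(4) sub] by simp
    qed
    ultimately have "\<forall>\<^sub>F n in sequentially. measure lebesgue S - e < measure lebesgue (A n)"
      using \<open>e > 0\<close> by (intro order_tendstoD(1)) auto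
    then obtain n where n: "measure lebesgue S - e < measure lebesgue (A n)"
      using eventually_happens by force
    define D where "D = I ` g ` {..<n}"
    have D: "\<exists>u v. (u, v) \<in> K \<and> u < v \<and> k = {u..v}" if k: "k \<in> D" for k
    proof -
      from k obtain i where i: "i \<in> C" "k = I i" unfolding D_def g[symmetric] by auto
      then show ?thesis using C(2) by (cases i) (auto simp: K'_def I_def)
    qed
    have pw: "pairwise disjnt D"
    proof (intro pairwiseI)
      fix k l assume kl: "k \<in> D" "l \<in> D" "k \<noteq> l"
      then obtain i j where "i \<in> C" "j \<in> C" "k = I i" "l = I j"
        unfolding D_def g[symmetric] by blast
      then show "disjnt k l" using C(3) kl(3) unfolding cb pairwise_def by auto
    qed
    have div: "D division_of \<Union>D"
    proof (rule division_ofI)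
      show "finite D" by (simp add: D_def)
      fix k assume k: "k \<in> D"
      show "k \<noteq> {}" "\<exists>a b. k = cbox a b" "k \<subseteq> \<Union>D" using D[OF k] k by auto
      fix l assume "l \<in> D" "k \<noteq> l"
      then have "k \<inter> l = {}" using pw k by (auto simp: pairwise_def disjnt_def)
      then show "interior k \<inter> interior l = {}" using interior_subset by fastforce
    qed simp
    have "measure lebesgue (A n) \<le> measure lebesgue (\<Union>D)"
      using Ameas sum_lengths_division(2)[OF div]
      by (intro measure_mono_fmeasurable) (auto simp: A_def D_def)
    then have "measure lebesgue S - e < (\<Sum>k\<in>D. Sup k - Inf k)"
      using n sum_lengths_division(1)[OF div] by simp
    with div pw D show ?thesis by (intro that)
  qed
qed

text \<open>For fixed \<open>d\<close> the set is a union of open intervals, hence open for an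
  arbitrary \<open>P\<close>. The condition weakens as \<open>d\<close> grows, so the values
  \<open>1 / (n + 1)\<close> suffice and the set is a countable intersection of open sets.\<close>

lemma sets_small_interval_property:
  fixes P :: "real \<Rightarrow> real \<Rightarrow> bool"
  shows "{x. \<forall>d>0. \<exists>u v. u < x \<and> x < v \<and> v - u < d \<and> P u v} \<in> sets borel"
proof -
  define U where "U = (\<lambda>d::real. \<Union>p\<in>{(u, v). v - u < d \<and> P u v}. {fst p<..<snd p})"
  have U: "x \<in> U d \<longleftrightarrow> (\<exists>u v. u < x \<and> x < v \<and> v - u < d \<and> P u v)" for x d
    unfolding U_def by auto
  have "{x. \<forall>d>0. \<exists>u v. u < x \<and> x < v \<and> v - u < d \<and> P u v} = (\<Inter>n. U (inverse (real (Suc n))))"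
  proof (intro set_eqI iffI)
    fix x assume x: "x \<in> (\<Inter>n. U (inverse (real (Suc n))))"
    have "x \<in> U d" if "d > 0" for d
    proof -
      obtain n where "inverse (real (Suc n)) < d" using reals_Archimedean[OF \<open>d > 0\<close>] by blast
      moreover have "x \<in> U (inverse (real (Suc n)))" using x by blast
      ultimately show ?thesis unfolding U by (meson order.strict_trans)
    qed
    then show "x \<in> {x. \<forall>d>0. \<exists>u v. u < x \<and> x < v \<and> v - u < d \<and> P u v}" unfolding U by blast
  next
    fix x assume "x \<in> {x. \<forall>d>0. \<exists>u v. u < x \<and> x < v \<and> v - u < d \<and> P u v}"
    then show "x \<in> (\<Inter>n. U (inverse (real (Suc n))))" unfolding U[symmetric] by simp
  qed
  moreover have "open (U d)" for d unfolding U_def by auto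
  ultimately show ?thesis by auto
qed

text \<open>
  Cover the exceptional set efficiently by disjoint intervals with difference quotient below \<open>p\<close>, and
  then again, inside these, by intervals with quotient above \<open>q\<close>. The two families differ by a set of
  small measure, on which absolute continuity makes the increments of \<open>g\<close> negligible.
\<close>

lemma oscillating_quotients_negligible:
  fixes g :: "real \<Rightarrow> real"
  assumes ac: "abs_continuous_on {a..b} (\<lambda>x. of_real (g x))" and "p < q"
  shows "negligible {x \<in> {a<..<b}.
      (\<forall>d>0. \<exists>u v. u < x \<and> x < v \<and> v - u < d \<and> g v - g u < p * (v - u)) \<and>
      (\<forall>d>0. \<exists>u v. u < x \<and> x < v \<and> v - u < d \<and> q * (v - u) < g v - g u)}" (is "negligible ?E")
proof -
  define E where "E = ?E"
  have Eborel: "E \<in> sets borel"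
  proof -
    have "E = {a<..<b}
        \<inter> {x. \<forall>d>0. \<exists>u v. u < x \<and> x < v \<and> v - u < d \<and> g v - g u < p * (v - u)}
        \<inter> {x. \<forall>d>0. \<exists>u v. u < x \<and> x < v \<and> v - u < d \<and> q * (v - u) < g v - g u}"
      unfolding E_def by auto
    then show ?thesis by (simp only: sets.Int sets_small_interval_property borel_open open_greaterThanLessThan)
  qed
  have Elow: "\<forall>d>0. \<exists>u v. u < x \<and> x < v \<and> v - u < d \<and> g v - g u < p * (v - u)"
    and Ehigh: "\<forall>d>0. \<exists>u v. u < x \<and> x < v \<and> v - u < d \<and> q * (v - u) < g v - g u"
    and Eab: "a < x" "x < b" if "x \<in> E" for x
    using that unfolding E_def by auto
  have Elm: "X \<in> lmeasurable" if "X \<in> sets lebesgue" "X \<subseteq> {a<..<b}" for X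
    using that bounded_subset[OF bounded_box[of a b, unfolded box_real]]
    by (blast intro: bounded_set_imp_lmeasurable)
  have E: "E \<in> lmeasurable" using Eborel Eab by (intro Elm) auto
  \<comment> \<open>The constant collects three errors: \<open>\<epsilon>\<close> for the increments
    of \<open>g\<close> over the gaps between the two families,
    \<open>\<bar>q\<bar> * \<epsilon>\<close> for the length of these gaps, and
    \<open>(q - p) * \<epsilon>\<close> for the excess of the measure of \<open>E\<close> over the
    length of the first family.\<close>
  have main: "(q - p) * measure lebesgue E \<le> \<epsilon> * (1 + \<bar>q\<bar> + (q - p))" if "\<epsilon> > 0" for \<epsilon>
  proof -
    obtain \<delta>' where \<delta>': "\<delta>' > 0" "\<And>d. d division_of \<Union>d \<Longrightarrow> \<Union>d \<subseteq> {a..b} \<Longrightarrow>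
        (\<Sum>k\<in>d. Sup k - Inf k) < \<delta>' \<Longrightarrow>
        (\<Sum>k\<in>d. cmod (complex_of_real (g (Sup k)) - of_real (g (Inf k)))) < \<epsilon>"
      using abs_continuous_onE[OF ac \<open>\<epsilon> > 0\<close>] by blast
    define \<delta> where "\<delta> = min \<delta>' \<epsilon>"
    have \<delta>: "\<delta> > 0" "\<delta> \<le> \<delta>'" "\<delta> \<le> \<epsilon>" using \<delta>' \<open>\<epsilon> > 0\<close> by (auto simp: \<delta>_def)
    \<comment> \<open>Intervals chosen inside an open set barely larger than \<open>E\<close> lie in
      \<open>E\<close> up to measure \<delta>/2, so that almost all of their length can be covered a
      second time.\<close>
    obtain T where T: "open T" "E \<subseteq> T" "T - E \<in> lmeasurable"
        "emeasure lebesgue (T - E) < ennreal (\<delta> / 2)"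
      using sets_lebesgue_outer_open[of E "\<delta> / 2"] E \<delta>(1) by auto
    define U where "U = T \<inter> {a<..<b}"
    have U: "open U" "E \<subseteq> U" "U \<subseteq> {a<..<b}" using T(1,2) Eab unfolding U_def by auto
    have UE: "U - E \<in> lmeasurable"
      using U Eborel by (intro Elm) auto
    have "measure lebesgue (U - E) \<le> measure lebesgue (T - E)"
      using T UE by (intro measure_mono_fmeasurable) (auto simp: U_def)
    also have "\<dots> < \<delta> / 2"
      using T(3,4) \<delta>(1) by (simp add: emeasure_eq_measure2 ennreal_less_iff)
    finally have mUE: "measure lebesgue (U - E) < \<delta> / 2" .
    define K1 where "K1 = {(u, v). {u..v} \<subseteq> U \<and> g v - g u < p * (v - u)}"
    have "\<exists>u v. (u, v) \<in> K1 \<and> u < x \<and> x < v \<and> v - u < d" if x: "x \<in> E" and "0 < d" for x d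
    proof -
      obtain \<eta> where \<eta>: "\<eta> > 0" "cball x \<eta> \<subseteq> U"
        using U x by (meson open_contains_cball subsetD)
      have "min d \<eta> > 0" using \<open>0 < d\<close> \<eta>(1) by simp
      then obtain u v where uv: "u < x" "x < v" "v - u < min d \<eta>" "g v - g u < p * (v - u)"
        using Elow[OF x] by blast
      have "{u..v} \<subseteq> cball x \<eta>" using uv by (auto simp: dist_real_def)
      with uv \<eta> show ?thesis unfolding K1_def by (intro exI[of _ u] exI[of _ v]) auto
    qed
    then obtain D1 where
      D1: "D1 division_of \<Union>D1" "pairwise disjnt D1"
        "\<And>k. k \<in> D1 \<Longrightarrow> \<exists>u v. (u, v) \<in> K1 \<and> u < v \<and> k = {u..v}"
        "measure lebesgue E - \<delta> < (\<Sum>k\<in>D1. Sup k - Inf k)"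
      using Vitali_finite_intervals[OF E \<delta>(1), of K1] by blast
    have D1': "k \<subseteq> U" "{Inf k..Sup k} = k" "Inf k < Sup k" "g (Sup k) - g (Inf k) < p * (Sup k - Inf k)"
      if "k \<in> D1" for k
      using D1(3)[OF that] by (auto simp: K1_def)
    have finD1: "finite D1" using D1(1) by auto
    define L1 where "L1 = (\<Sum>k\<in>D1. Sup k - Inf k)"
    \<comment> \<open>Leaving out the end points gives every point room for a smaller interval
      inside the same member of \<open>D1\<close>, at the cost of a finite set.\<close>
    define E2 where "E2 = E \<inter> (\<Union>k\<in>D1. {Inf k<..<Sup k})"
    have E2: "E2 \<in> lmeasurable"
      using Eborel finD1 Eab unfolding E2_def
      by (intro Elm sets.Int sets_completionI_sets borel_open open_UN) auto
    have "L1 = measure lebesgue (\<Union>D1)"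
      unfolding L1_def using sum_lengths_division(1)[OF D1(1)] .
    also have "\<dots> \<le> measure lebesgue (E2 \<union> (U - E) \<union> (Inf ` D1 \<union> Sup ` D1))"
    proof (rule measure_mono_fmeasurable)
      show "\<Union>D1 \<subseteq> E2 \<union> (U - E) \<union> (Inf ` D1 \<union> Sup ` D1)"
      proof
        fix x assume "x \<in> \<Union>D1"
        then obtain k where k: "k \<in> D1" "x \<in> k" by blast
        then have "x \<in> U" "Inf k \<le> x" "x \<le> Sup k" using D1'(1,2)[OF k(1)] atLeastAtMost_iff[of x "Inf k" "Sup k"] by auto
        moreover have "x \<in> E2" if "x \<in> E" "Inf k < x" "x < Sup k"
          unfolding E2_def using that k(1) by (intro IntI UN_I[of k]) simp_all
        ultimately show "x \<in> E2 \<union> (U - E) \<union> (Inf ` D1 \<union> Sup ` D1)"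
          using k(1) by (cases "x = Inf k"; cases "x = Sup k") auto
      qed
      show "E2 \<union> (U - E) \<union> (Inf ` D1 \<union> Sup ` D1) \<in> lmeasurable"
        using E2 UE finD1 by (intro fmeasurable.Un) (auto intro!: negligible_imp_measurable)
    qed (use sum_lengths_division(2)[OF D1(1)] in auto)
    also have "\<dots> \<le> measure lebesgue E2 + measure lebesgue (U - E) + measure lebesgue (Inf ` D1 \<union> Sup ` D1)"
    proof -
      have N: "Inf ` D1 \<union> Sup ` D1 \<in> sets lebesgue"
        using finD1 by (intro fmeasurableD negligible_imp_measurable) auto
      show ?thesis
        using measure_Un_le[OF sets.Un[OF fmeasurableD[OF E2] fmeasurableD[OF UE]] N]
          measure_Un_le[OF fmeasurableD[OF E2] fmeasurableD[OF UE]]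
        by linarith
    qed
    also have "measure lebesgue (Inf ` D1 \<union> Sup ` D1) = 0"
      using finD1 by (intro negligible_imp_measure0) auto
    finally have mE2: "L1 - \<delta> / 2 < measure lebesgue E2" using mUE by simp
    define K2 where "K2 = {(u, v). (\<exists>k\<in>D1. {u..v} \<subseteq> k) \<and> q * (v - u) < g v - g u}"
    have "\<exists>u v. (u, v) \<in> K2 \<and> u < x \<and> x < v \<and> v - u < d" if x: "x \<in> E2" and "0 < d" for x d
    proof -
      obtain k where k: "k \<in> D1" "Inf k < x" "x < Sup k" using x unfolding E2_def by auto
      define \<eta> where "\<eta> = min d (min (x - Inf k) (Sup k - x))"
      have "\<eta> > 0" using \<open>0 < d\<close> k by (auto simp: \<eta>_def)
      moreover have "\<forall>d>0. \<exists>u v. u < x \<and> x < v \<and> v - u < d \<and> q * (v - u) < g v - g u"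
        using x Ehigh unfolding E2_def by blast
      ultimately obtain u v where uv: "u < x" "x < v" "v - u < \<eta>" "q * (v - u) < g v - g u" by blast
      have "{u..v} \<subseteq> {Inf k..Sup k}" using uv k by (auto simp: \<eta>_def)
      then have "{u..v} \<subseteq> k" using D1'(2)[OF k(1)] by simp
      with uv k show ?thesis unfolding K2_def \<eta>_def by (intro exI[of _ u] exI[of _ v]) auto
    qed
    then obtain D2 where
      D2: "D2 division_of \<Union>D2" "pairwise disjnt D2"
        "\<And>k. k \<in> D2 \<Longrightarrow> \<exists>u v. (u, v) \<in> K2 \<and> u < v \<and> k = {u..v}"
        "measure lebesgue E2 - \<delta> / 2 < (\<Sum>k\<in>D2. Sup k - Inf k)"
      using Vitali_finite_intervals[OF E2 half_gt_zero[OF \<delta>(1)], of K2] by blast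
    have D2': "\<exists>k\<in>D1. l \<subseteq> k" "l \<noteq> {}" "q * (Sup l - Inf l) < g (Sup l) - g (Inf l)"
      if "l \<in> D2" for l
      using D2(3)[OF that] by (auto simp: K2_def)
    have finD2: "finite D2" using D2(1) by auto
    define L2 where "L2 = (\<Sum>k\<in>D2. Sup k - Inf k)"
    have L2: "L1 - \<delta> < L2" using D2(4) mE2 unfolding L2_def by simp
    define P where "P = (\<lambda>k. {l \<in> D2. l \<subseteq> k})"
    \<comment> \<open>The members of \<open>D2\<close> inside \<open>k\<close> are completed to a
      division of \<open>k\<close>; the added pieces are the gaps, collected in \<open>R\<close>
      below.\<close>
    have "\<exists>r. P k \<subseteq> r \<and> r division_of {Inf k..Sup k}" if "k \<in> D1" for k
    proof -
      have "P k division_of \<Union>(P k)"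
        using D2(1) by (rule division_of_subset) (auto simp: P_def)
      moreover have "\<Union>(P k) \<subseteq> cbox (Inf k) (Sup k)"
        unfolding box_real D1'(2)[OF that] P_def by blast
      ultimately show ?thesis
        by (metis partial_division_extend_interval box_real(2))
    qed
    then obtain r where r: "\<And>k. k \<in> D1 \<Longrightarrow> P k \<subseteq> r k"
        "\<And>k. k \<in> D1 \<Longrightarrow> r k division_of {Inf k..Sup k}" by metis
    have rsub: "l \<subseteq> k" "l \<noteq> {}" if "k \<in> D1" "l \<in> r k" for k l
      using division_ofD(2,3)[OF r(2)[OF that(1)] that(2)] unfolding D1'(2)[OF that(1)] by blast+
    have finr: "finite (r k)" if "k \<in> D1" for k using r(2)[OF that] by auto
    have D1disj: "k \<inter> k' = {}" if "k \<in> D1" "k' \<in> D1" "k \<noteq> k'" for k k'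
      using D1(2) that by (auto simp: pairwise_def disjnt_def)
    define R where "R = (\<Union>k\<in>D1. r k - P k)"
    \<comment> \<open>Members of \<open>D1\<close> are disjoint, not merely non-overlapping, so each
      nonempty piece lies in exactly one of them and the sums can be regrouped.\<close>
    have sumR: "(\<Sum>l\<in>R. h l) = (\<Sum>k\<in>D1. \<Sum>l\<in>r k. h l) - (\<Sum>l\<in>D2. h l)" for h :: "real set \<Rightarrow> real"
    proof -
      have "D2 = (\<Union>k\<in>D1. P k)" using D2'(1) unfolding P_def by auto
      then have "(\<Sum>l\<in>D2. h l) = (\<Sum>l\<in>(\<Union>k\<in>D1. P k). h l)" by simp
      also have "\<dots> = (\<Sum>k\<in>D1. \<Sum>l\<in>P k. h l)"
        using D1disj D2'(2) finD2 by (intro sum.UNION_disjoint finD1) (fastforce simp: P_def)+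
      finally have 1: "(\<Sum>l\<in>D2. h l) = (\<Sum>k\<in>D1. \<Sum>l\<in>P k. h l)" .
      have "(\<Sum>l\<in>R. h l) = (\<Sum>k\<in>D1. \<Sum>l\<in>r k - P k. h l)"
        unfolding R_def
      proof (intro sum.UNION_disjoint finD1 ballI impI)
        fix k k' assume k: "k \<in> D1" "k' \<in> D1" "k \<noteq> k'"
        have "l \<notin> r k'" if "l \<in> r k" for l
          using rsub[OF k(1) that] rsub(1)[OF k(2), of l] D1disj[OF k] by blast
        then show "(r k - P k) \<inter> (r k' - P k') = {}" by auto
      qed (use finr in auto)
      also have "\<dots> = (\<Sum>k\<in>D1. (\<Sum>l\<in>r k. h l) - (\<Sum>l\<in>P k. h l))"
        by (intro sum.cong refl sum_diff finr r)
      also have "\<dots> = (\<Sum>k\<in>D1. \<Sum>l\<in>r k. h l) - (\<Sum>l\<in>D2. h l)"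
        by (simp add: sum_subtractf 1)
      finally show ?thesis .
    qed
    have incr: "(\<Sum>l\<in>r k. F (Sup l) - F (Inf l)) = F (Sup k) - F (Inf k)" if "k \<in> D1"
      for F :: "real \<Rightarrow> real" and k
      using sum_increments_division[OF r(2)[OF that]] D1'(3)[OF that] by simp
    have Rdiv: "R division_of \<Union>R"
    proof (rule division_ofI)
      show "finite R" using finD1 finr unfolding R_def by auto
      fix l assume "l \<in> R"
      then obtain k where k: "k \<in> D1" "l \<in> r k" unfolding R_def by auto
      show "l \<noteq> {}" "\<exists>u v. l = cbox u v"
        using division_ofD(3,4)[OF r(2)[OF k(1)] k(2)] by auto
      fix l' assume "l' \<in> R" "l \<noteq> l'"
      then obtain k' where k': "k' \<in> D1" "l' \<in> r k'" unfolding R_def by auto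
      show "interior l \<inter> interior l' = {}"
      proof (cases "k = k'")
        case True
        then show ?thesis using division_ofD(5)[OF r(2)[OF k(1)] k(2)] k' \<open>l \<noteq> l'\<close> by auto
      next
        case False
        then have "l \<inter> l' = {}"
          using D1disj[OF k(1) k'(1)] rsub(1)[OF k] rsub(1)[OF k'] by blast
        then show ?thesis by (metis interior_Int interior_empty)
      qed
    qed auto
    have RL: "(\<Sum>l\<in>R. Sup l - Inf l) = L1 - L2"
      using incr[of _ "\<lambda>x. x"] by (simp add: sumR L1_def L2_def)
    have "(\<Sum>l\<in>R. Sup l - Inf l) \<ge> 0"
      using division_member_endpoints(2)[OF Rdiv] by (intro sum_nonneg) auto
    with RL have L21: "L2 \<le> L1" by simp
    have Rsub: "\<Union>R \<subseteq> {a..b}"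
    proof
      fix x assume "x \<in> \<Union>R"
      then obtain k l where kl: "k \<in> D1" "l \<in> r k" "x \<in> l" unfolding R_def by auto
      then have "x \<in> U" using rsub(1)[OF kl(1,2)] D1'(1)[OF kl(1)] by blast
      then show "x \<in> {a..b}" using U(3) by auto
    qed
    \<comment> \<open>The gaps have total length \<open>L1 - L2\<close>, which is below \<delta>.
      Hence \<open>g\<close> changes by less than \<epsilon> over all of them together, and its
      increments over the two families nearly agree.\<close>
    have "\<bar>\<Sum>l\<in>R. g (Sup l) - g (Inf l)\<bar> \<le> (\<Sum>l\<in>R. cmod (complex_of_real (g (Sup l)) - of_real (g (Inf l))))"
      by (rule order.trans[OF sum_abs]) (simp flip: of_real_diff)
    also have "\<dots> < \<epsilon>"
      using L2 \<delta>(2) RL by (intro \<delta>'(2) Rdiv Rsub) simp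
    finally have "\<bar>(\<Sum>k\<in>D1. g (Sup k) - g (Inf k)) - (\<Sum>l\<in>D2. g (Sup l) - g (Inf l))\<bar> < \<epsilon>"
      using incr[of _ g] by (simp add: sumR)
    moreover have "(\<Sum>k\<in>D1. g (Sup k) - g (Inf k)) \<le> p * L1"
      unfolding L1_def sum_distrib_left using D1'(4) by (intro sum_mono less_imp_le)
    moreover have "q * L2 \<le> (\<Sum>l\<in>D2. g (Sup l) - g (Inf l))"
      unfolding L2_def sum_distrib_left using D2'(3) by (intro sum_mono less_imp_le)
    ultimately have "q * L2 \<le> p * L1 + \<epsilon>" by linarith
    moreover have "q * (L1 - L2) \<le> \<bar>q\<bar> * \<epsilon>"
      using L2 L21 \<delta>(3) mult_mono[of q "\<bar>q\<bar>" "L1 - L2" \<epsilon>] by auto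
    moreover have "(q - p) * measure lebesgue E \<le> (q - p) * (L1 + \<epsilon>)"
      using D1(4) \<delta>(3) \<open>p < q\<close> unfolding L1_def[symmetric] by (intro mult_left_mono) auto
    ultimately show ?thesis by (simp add: algebra_simps)
  qed
  have "(q - p) * measure lebesgue E \<le> 0"
  proof (rule field_le_epsilon)
    fix e :: real assume "e > 0"
    define C where "C = 1 + \<bar>q\<bar> + (q - p)"
    have "C > 0" using \<open>p < q\<close> by (auto simp: C_def)
    then show "(q - p) * measure lebesgue E \<le> 0 + e"
      using main[of "e / C"] \<open>e > 0\<close> by (simp add: C_def[symmetric])
  qed
  then have "measure lebesgue E = 0"
    using \<open>p < q\<close> by (simp add: mult_le_0_iff measure_le_0_iff)
  then show ?thesis using E unfolding E_def[symmetric] by (simp add: negligible_iff_measure)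
qed

text \<open>Inside a ball of length below \<delta>, increments over disjoint intervals add up to
  less than 1, so intervals with quotient above \<open>2 / e\<close> have total length below
  \<open>e / 2\<close>; the covering loses another \<open>e / 2\<close>. Negligibility is local, so
  balls of one fixed radius suffice. Quotients unbounded below are treated by passing to
  \<open>- g\<close>.\<close>

lemma unbounded_quotients_negligible:
  fixes g :: "real \<Rightarrow> real"
  assumes ac: "abs_continuous_on {a..b} (\<lambda>x. of_real (g x))"
  shows "negligible {x \<in> {a<..<b}.
      \<forall>M. \<forall>d>0. \<exists>u v. u < x \<and> x < v \<and> v - u < d \<and> M * (v - u) < g v - g u}" (is "negligible ?S")
proof -
  obtain \<delta> where \<delta>: "\<delta> > 0" "\<And>d. d division_of \<Union>d \<Longrightarrow> \<Union>d \<subseteq> {a..b} \<Longrightarrow>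
      (\<Sum>k\<in>d. Sup k - Inf k) < \<delta> \<Longrightarrow>
      (\<Sum>k\<in>d. cmod (complex_of_real (g (Sup k)) - of_real (g (Inf k)))) < 1"
    using abs_continuous_onE[OF ac zero_less_one] by blast
  have neg: "negligible (?S \<inter> ball z (\<delta> / 3))" for z
    unfolding negligible_outer_le
  proof (intro allI impI)
    fix e :: real assume "e > 0"
    define B where "B = ball z (\<delta> / 3) \<inter> {a<..<b}"
    \<comment> \<open>Keeping only the single level \<open>2 / e\<close> enlarges the set to a
      measurable one, as the covering lemma requires.\<close>
    define T where "T = B \<inter>
      {x. \<forall>d>0. \<exists>u v. u < x \<and> x < v \<and> v - u < d \<and> 2 / e * (v - u) < g v - g u}"
    have B: "open B" "B \<in> lmeasurable" by (auto simp: B_def fmeasurable_Int_fmeasurable)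
    have T: "T \<in> lmeasurable"
      unfolding T_def using sets_small_interval_property B(2)
      by (intro fmeasurable_Int_fmeasurable) (auto intro: sets_completionI_sets)
    define K where "K = {(u, v). {u..v} \<subseteq> B \<and> 2 / e * (v - u) < g v - g u}"
    have K: "\<exists>u v. (u, v) \<in> K \<and> u < x \<and> x < v \<and> v - u < d" if x: "x \<in> T" and "0 < d" for x d
    proof -
      obtain \<eta> where \<eta>: "\<eta> > 0" "cball x \<eta> \<subseteq> B"
        using B(1) x unfolding T_def by (meson IntD1 open_contains_cball)
      have "min d \<eta> > 0" using \<open>0 < d\<close> \<eta>(1) by simp
      then obtain u v where uv: "u < x" "x < v" "v - u < min d \<eta>" "2 / e * (v - u) < g v - g u"
        using x unfolding T_def by blast
      have "{u..v} \<subseteq> cball x \<eta>" using uv by (auto simp: dist_real_def)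
      with uv \<eta> show ?thesis unfolding K_def by (intro exI[of _ u] exI[of _ v]) auto
    qed
    obtain D where D: "D division_of \<Union>D" "pairwise disjnt D"
        "\<And>k. k \<in> D \<Longrightarrow> \<exists>u v. (u, v) \<in> K \<and> u < v \<and> k = {u..v}"
        "measure lebesgue T - e / 2 < (\<Sum>k\<in>D. Sup k - Inf k)"
      by (rule Vitali_finite_intervals[OF T half_gt_zero[OF \<open>e > 0\<close>] K]) (assumption, assumption, rule that)
    have D': "k \<subseteq> B" "2 / e * (Sup k - Inf k) < g (Sup k) - g (Inf k)" if "k \<in> D" for k
      using D(3)[OF that] by (auto simp: K_def)
    have DB: "\<Union>D \<subseteq> B" using D'(1) by blast
    have "(\<Sum>k\<in>D. Sup k - Inf k) \<le> measure lebesgue (ball z (\<delta> / 3))"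
      unfolding sum_lengths_division(1)[OF D(1)] using DB sum_lengths_division(2)[OF D(1)]
      by (intro measure_mono_fmeasurable) (auto simp: B_def)
    also have "\<dots> < \<delta>" using \<delta>(1) by (simp add: ball_eq_greaterThanLessThan)
    finally have len: "(\<Sum>k\<in>D. Sup k - Inf k) < \<delta>" .
    have "2 / e * (\<Sum>k\<in>D. Sup k - Inf k) \<le> (\<Sum>k\<in>D. g (Sup k) - g (Inf k))"
      unfolding sum_distrib_left using D'(2) by (intro sum_mono less_imp_le)
    also have "\<dots> \<le> (\<Sum>k\<in>D. cmod (complex_of_real (g (Sup k)) - of_real (g (Inf k))))"
      by (intro sum_mono) (simp flip: of_real_diff)
    also have "\<dots> < 1"
      using DB by (intro \<delta>(2) D(1) len) (auto simp: B_def)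
    finally have "(\<Sum>k\<in>D. Sup k - Inf k) < e / 2" using \<open>e > 0\<close> by (simp add: field_simps)
    then have "measure lebesgue T \<le> e" using D(4) by simp
    moreover have "?S \<inter> ball z (\<delta> / 3) \<subseteq> T" unfolding T_def B_def by blast
    ultimately show "\<exists>T. ?S \<inter> ball z (\<delta> / 3) \<subseteq> T \<and> T \<in> lmeasurable \<and> measure lebesgue T \<le> e"
      using T by blast
  qed
  show ?thesis
    unfolding locally_negligible_alt[of ?S]
  proof (rule ballI)
    fix x assume "x \<in> ?S"
    then show "\<exists>U. openin (top_of_set ?S) U \<and> x \<in> U \<and> negligible U"
      using \<delta>(1) by (intro exI[of _ "?S \<inter> ball x (\<delta> / 3)"] conjI neg) auto
  qed
qed

section \<open>From straddling difference quotients to derivatives\<close>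

text \<open>Continuity at \<open>x\<close> allows one end point to tend to \<open>x\<close> while
  the other stays fixed, so the estimate over straddling intervals passes to the increments on
  either side of \<open>x\<close>.\<close>

lemma has_real_derivative_straddle:
  fixes g :: "real \<Rightarrow> real"
  assumes cont: "isCont g x"
    and straddle: "\<And>e. e > 0 \<Longrightarrow> \<exists>d>0. \<forall>u v. u < x \<longrightarrow> x < v \<longrightarrow> v - u < d \<longrightarrow>
      \<bar>g v - g u - L * (v - u)\<bar> \<le> e * (v - u)"
  shows "(g has_real_derivative L) (at x)"
proof -
  have "\<exists>d>0. \<forall>y. norm (y - x) < d \<longrightarrow> norm (g y - g x - L * (y - x)) \<le> e * norm (y - x)"
    if "e > 0" for e
  proof -
    obtain d where d: "d > 0" "\<And>u v. u < x \<Longrightarrow> x < v \<Longrightarrow> v - u < d \<Longrightarrow>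
        \<bar>g v - g u - L * (v - u)\<bar> \<le> e * (v - u)" using straddle[OF \<open>e > 0\<close>] by blast
    have lim: "(g \<longlongrightarrow> g x) (at x within S)" for S
      using cont continuous_at_imp_continuous_within continuous_within by blast
    have right: "\<bar>g y - g x - L * (y - x)\<bar> \<le> e * (y - x)" if y: "x < y" "y - x < d" for y
    proof (rule tendsto_le)
      show "((\<lambda>u. \<bar>g y - g u - L * (y - u)\<bar>) \<longlongrightarrow> \<bar>g y - g x - L * (y - x)\<bar>) (at_left x)"
        by (intro tendsto_intros lim)
      show "((\<lambda>u. e * (y - u)) \<longlongrightarrow> e * (y - x)) (at_left x)"
        by (intro tendsto_intros)
      show "\<forall>\<^sub>F u in at_left x. \<bar>g y - g u - L * (y - u)\<bar> \<le> e * (y - u)"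
        using eventually_at_left_real[of "y - d" x] y
        by (auto elim!: eventually_mono intro!: d)
    qed simp
    have left: "\<bar>g x - g y - L * (x - y)\<bar> \<le> e * (x - y)" if y: "y < x" "x - y < d" for y
    proof (rule tendsto_le)
      show "((\<lambda>v. \<bar>g v - g y - L * (v - y)\<bar>) \<longlongrightarrow> \<bar>g x - g y - L * (x - y)\<bar>) (at_right x)"
        by (intro tendsto_intros lim)
      show "((\<lambda>v. e * (v - y)) \<longlongrightarrow> e * (x - y)) (at_right x)"
        by (intro tendsto_intros)
      show "\<forall>\<^sub>F v in at_right x. \<bar>g v - g y - L * (v - y)\<bar> \<le> e * (v - y)"
        using eventually_at_right_real[of x "y + d"] y
        by (auto elim!: eventually_mono intro!: d)
    qed simp
    have "norm (g y - g x - L * (y - x)) \<le> e * norm (y - x)" if "norm (y - x) < d" for y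
    proof (cases "x < y")
      case True
      then show ?thesis using right[of y] that by auto
    next
      case False
      have "g y - g x - L * (y - x) = - (g x - g y - L * (x - y))" by (simp add: algebra_simps)
      with False that left[of y] show ?thesis by (cases "y = x") auto
    qed
    with d(1) show ?thesis by blast
  qed
  then show ?thesis
    unfolding has_field_derivative_def has_derivative_at_alt by (auto intro: bounded_linear_mult_right)
qed

text \<open>The derivative \<open>L\<close> is the lower limit of the straddling quotients, that is,
  the supremum of their eventual lower bounds; \<open>upper\<close> and \<open>lower\<close> make it
  finite. A larger upper limit would leave room for two rational levels that contradict
  \<open>osc\<close>. Only rational levels are used, so that countably many exceptional sets are
  involved.\<close>

lemma straddle_quotients_dichotomy:
  fixes g :: "real \<Rightarrow> real"
  assumes cont: "isCont g x"
    and osc: "\<And>p q. p \<in> \<rat> \<Longrightarrow> q \<in> \<rat> \<Longrightarrow> p < q \<Longrightarrow>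
      \<not> ((\<forall>d>0. \<exists>u v. u < x \<and> x < v \<and> v - u < d \<and> g v - g u < p * (v - u)) \<and>
        (\<forall>d>0. \<exists>u v. u < x \<and> x < v \<and> v - u < d \<and> q * (v - u) < g v - g u))"
    and upper: "\<not> (\<forall>M. \<forall>d>0. \<exists>u v. u < x \<and> x < v \<and> v - u < d \<and> M * (v - u) < g v - g u)"
    and lower: "\<not> (\<forall>M. \<forall>d>0. \<exists>u v. u < x \<and> x < v \<and> v - u < d \<and> M * (v - u) < - g v - - g u)"
  shows "\<exists>L. (g has_real_derivative L) (at x)"
proof -
  define A where "A p \<longleftrightarrow> (\<forall>d>0. \<exists>u v. u < x \<and> x < v \<and> v - u < d \<and> g v - g u < p * (v - u))" for p
  define B where "B q \<longleftrightarrow> (\<forall>d>0. \<exists>u v. u < x \<and> x < v \<and> v - u < d \<and> q * (v - u) < g v - g u)" for q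
  have AB: "\<not> (A p \<and> B q)" if "p \<in> \<rat>" "q \<in> \<rat>" "p < q" for p q
    using osc[OF that] unfolding A_def B_def .
  obtain M where M: "\<not> B M" using upper unfolding B_def by blast
  obtain N where N: "\<not> A (- N)" using lower unfolding A_def by (auto simp: algebra_simps)
  have Amono: "A p'" if "A p" "p \<le> p'" for p p'
    unfolding A_def
  proof (intro allI impI)
    fix d :: real assume "d > 0"
    then obtain u v where uv: "u < x" "x < v" "v - u < d" "g v - g u < p * (v - u)"
      using \<open>A p\<close> unfolding A_def by blast
    moreover have "p * (v - u) \<le> p' * (v - u)" using uv \<open>p \<le> p'\<close> by (intro mult_right_mono) auto
    ultimately show "\<exists>u v. u < x \<and> x < v \<and> v - u < d \<and> g v - g u < p' * (v - u)"
      by (meson order.strict_trans2)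
  qed
  have nonAB: "p \<le> q" if p: "\<not> A p" and q: "\<not> B q" for p q
  proof (rule ccontr)
    assume "\<not> p \<le> q"
    obtain d where d: "d > 0" "\<And>u v. u < x \<Longrightarrow> x < v \<Longrightarrow> v - u < d \<Longrightarrow> p * (v - u) \<le> g v - g u"
      using p unfolding A_def by (meson not_less)
    obtain d' where d': "d' > 0" "\<And>u v. u < x \<Longrightarrow> x < v \<Longrightarrow> v - u < d' \<Longrightarrow> g v - g u \<le> q * (v - u)"
      using q unfolding B_def by (meson not_less)
    \<comment> \<open>Both eventual bounds apply to the symmetric interval around \<open>x\<close>
      of length \<open>2 * h\<close>, which is shorter than \<open>d\<close> and
      \<open>d'\<close>.\<close>
    define h where "h = min d d' / 3"
    have h: "h > 0" "3 * h \<le> d" "3 * h \<le> d'" using d(1) d'(1) by (auto simp: h_def)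
    have "p * (2 * h) \<le> g (x + h) - g (x - h)"
      using d(2)[of "x - h" "x + h"] h by simp
    also have "\<dots> \<le> q * (2 * h)"
      using d'(2)[of "x - h" "x + h"] h by simp
    finally have "p * (2 * h) \<le> q * (2 * h)" .
    then show False using h \<open>\<not> p \<le> q\<close> by simp
  qed
  define L where "L = Sup {p. \<not> A p}"
  have bdd: "bdd_above {p. \<not> A p}" using nonAB M by (intro bdd_aboveI[of _ M]) auto
  have ne: "{p. \<not> A p} \<noteq> {}" using N by auto
  have "(g has_real_derivative L) (at x)"
  proof (rule has_real_derivative_straddle[OF cont])
    fix e :: real assume "e > 0"
    have "\<exists>p\<in>{p. \<not> A p}. L - e < p"
      using \<open>e > 0\<close> less_cSup_iff[OF ne bdd, of "L - e"] unfolding L_def by simp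
    then have "\<not> A (L - e)" using Amono by force
    moreover have "\<not> B (L + e)"
    proof
      assume BLe: "B (L + e)"
      \<comment> \<open>Levels \<open>L < p < q < L + e\<close>: \<open>A p\<close> holds because
        \<open>p\<close> exceeds the supremum \<open>L\<close>, and \<open>B q\<close> because
        \<open>q\<close> is a weaker demand than \<open>L + e\<close>.\<close>
      obtain p where p: "p \<in> \<rat>" "L < p" "p < L + e" using Rats_dense_in_real[of L "L + e"] \<open>e > 0\<close> by auto
      obtain q where q: "q \<in> \<rat>" "p < q" "q < L + e" using Rats_dense_in_real[of p "L + e"] p by auto
      have "A p" using p(2) cSup_upper[OF _ bdd, of p] unfolding L_def by force
      moreover have "B q"
        unfolding B_def
      proof (intro allI impI)
        fix d :: real assume "d > 0"
        then obtain u v where uv: "u < x" "x < v" "v - u < d" "(L + e) * (v - u) < g v - g u"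
          using BLe unfolding B_def by blast
        moreover have "q * (v - u) \<le> (L + e) * (v - u)" using uv q by (intro mult_right_mono) auto
        ultimately show "\<exists>u v. u < x \<and> x < v \<and> v - u < d \<and> q * (v - u) < g v - g u"
          by (meson order.strict_trans1)
      qed
      ultimately show False using AB p q by blast
    qed
    ultimately obtain d d' where d: "d > 0" "d' > 0"
      "\<And>u v. u < x \<Longrightarrow> x < v \<Longrightarrow> v - u < d \<Longrightarrow> (L - e) * (v - u) \<le> g v - g u"
      "\<And>u v. u < x \<Longrightarrow> x < v \<Longrightarrow> v - u < d' \<Longrightarrow> g v - g u \<le> (L + e) * (v - u)"
      unfolding A_def B_def by (meson not_less)
    have "\<bar>g v - g u - L * (v - u)\<bar> \<le> e * (v - u)"
      if uv: "u < x" "x < v" "v - u < min d d'" for u v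
      using d(3)[of u v] d(4)[of u v] uv by (auto simp: abs_le_iff algebra_simps)
    moreover have "min d d' > 0" using d by simp
    ultimately show "\<exists>d>0. \<forall>u v. u < x \<longrightarrow> x < v \<longrightarrow> v - u < d \<longrightarrow>
        \<bar>g v - g u - L * (v - u)\<bar> \<le> e * (v - u)" by blast
  qed
  then show ?thesis by blast
qed

text \<open>The exceptional points lie in one null set for each pair of rationals
  \<open>p < q\<close>, together with the sets of unbounded quotients of \<open>g\<close> and of
  \<open>- g\<close>. In the open interval continuity is two-sided, as the dichotomy
  requires.\<close>

lemma abs_continuous_real_differentiable_ae:
  fixes g :: "real \<Rightarrow> real"
  assumes ac: "abs_continuous_on {a..b} (\<lambda>x. of_real (g x))"
  shows "negligible {x \<in> {a<..<b}. \<not> (\<exists>L. (g has_real_derivative L) (at x))}"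
proof -
  let ?N = "\<lambda>(p, q). {x \<in> {a<..<b}.
      (\<forall>d>0. \<exists>u v. u < x \<and> x < v \<and> v - u < d \<and> g v - g u < p * (v - u)) \<and>
      (\<forall>d>0. \<exists>u v. u < x \<and> x < v \<and> v - u < d \<and> q * (v - u) < g v - g u)}"
  let ?I = "\<lambda>g. {x \<in> {a<..<b}.
      \<forall>M. \<forall>d>0. \<exists>u v. u < x \<and> x < v \<and> v - u < d \<and> M * (v - u) < g v - (g u :: real)}"
  let ?Q = "{(p, q). p \<in> \<rat> \<and> q \<in> \<rat> \<and> p < (q::real)}"
  have ac': "abs_continuous_on {a..b} (\<lambda>x. of_real (- g x))"
    by (rule abs_continuous_on_dominated[OF ac]) (simp add: norm_minus_commute flip: of_real_diff of_real_minus)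
  have "continuous_on {a..b} (\<lambda>x. Re (of_real (g x)))"
    by (intro continuous_on_Re abs_continuous_on_imp_continuous_on ac)
  then have cont: "isCont g x" if "x \<in> {a<..<b}" for x
    using continuous_on_interior[of "{a..b}" g x] that by (simp add: interior_atLeastAtMost_real)
  have "countable ?Q"
    by (rule countable_subset[of _ "\<rat> \<times> \<rat>"]) (auto simp: countable_rat)
  then have "negligible ((\<Union>i\<in>?Q. ?N i) \<union> ?I g \<union> ?I (\<lambda>x. - g x))"
    using oscillating_quotients_negligible[OF ac] unbounded_quotients_negligible[OF ac]
      unbounded_quotients_negligible[OF ac']
    by (intro negligible_Un negligible_countable_Union) auto
  moreover have "{x \<in> {a<..<b}. \<not> (\<exists>L. (g has_real_derivative L) (at x))}
      \<subseteq> (\<Union>i\<in>?Q. ?N i) \<union> ?I g \<union> ?I (\<lambda>x. - g x)"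
  proof (rule subsetI, rule ccontr)
    fix x assume x: "x \<in> {x \<in> {a<..<b}. \<not> (\<exists>L. (g has_real_derivative L) (at x))}"
      and nx: "x \<notin> (\<Union>i\<in>?Q. ?N i) \<union> ?I g \<union> ?I (\<lambda>x. - g x)"
    have xab: "x \<in> {a<..<b}" using x by blast
    have "\<exists>L. (g has_real_derivative L) (at x)"
    proof (rule straddle_quotients_dichotomy[OF cont[OF xab]])
      fix p q :: real assume "p \<in> \<rat>" "q \<in> \<rat>" "p < q"
      then have "(p, q) \<in> ?Q" by simp
      then have "x \<notin> ?N (p, q)" using nx by blast
      then show "\<not> ((\<forall>d>0. \<exists>u v. u < x \<and> x < v \<and> v - u < d \<and> g v - g u < p * (v - u)) \<and>
          (\<forall>d>0. \<exists>u v. u < x \<and> x < v \<and> v - u < d \<and> q * (v - u) < g v - g u))"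
        using xab by simp
    qed (use nx xab in auto)
    then show False using x by blast
  qed
  ultimately show ?thesis by (rule negligible_subset)
qed

text \<open>Real and imaginary parts are treated on the intervals from \<open>- n\<close> to
  \<open>n\<close>, which exhaust the line. The conclusion names \<open>vector_derivative\<close>,
  the function that enters \<open>diff_op\<close> and \<open>breve_T\<close>.\<close>

lemma locally_abs_continuous_differentiable_ae:
  assumes f: "locally_abs_continuous f"
  shows "AE x in lebesgue. (f has_vector_derivative vector_derivative f (at x)) (at x)"
proof -
  let ?N = "\<lambda>g n. {x \<in> {- real n<..<real n}. \<not> (\<exists>L. (g has_real_derivative L) (at x))}"
  have ac: "abs_continuous_on {a..b} f" for a b using f unfolding locally_abs_continuous_def by blast
  have "abs_continuous_on {a..b} (\<lambda>x. of_real (Re (f x)))" for a b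
    by (rule abs_continuous_on_dominated[OF ac])
      (simp flip: of_real_diff, metis abs_Re_le_cmod minus_complex.simps(1))
  note re = abs_continuous_real_differentiable_ae[OF this]
  have "abs_continuous_on {a..b} (\<lambda>x. of_real (Im (f x)))" for a b
    by (rule abs_continuous_on_dominated[OF ac])
      (simp flip: of_real_diff, metis abs_Im_le_cmod minus_complex.simps(2))
  note im = abs_continuous_real_differentiable_ae[OF this]
  have "negligible (\<Union>n. ?N (\<lambda>x. Re (f x)) n \<union> ?N (\<lambda>x. Im (f x)) n)"
    by (rule negligible_countable_Union) (simp, use negligible_Un[OF re im] in blast)
  then have N: "(\<Union>n. ?N (\<lambda>x. Re (f x)) n \<union> ?N (\<lambda>x. Im (f x)) n) \<in> null_sets lebesgue"
    by (simp add: negligible_iff_null_sets)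
  show ?thesis
  proof (rule AE_I'[OF N], rule subsetI, rule ccontr)
    fix x assume x: "x \<in> {x \<in> space lebesgue. \<not> (f has_vector_derivative vector_derivative f (at x)) (at x)}"
      and nx: "x \<notin> (\<Union>n. ?N (\<lambda>x. Re (f x)) n \<union> ?N (\<lambda>x. Im (f x)) n)"
    obtain n where "\<bar>x\<bar> < real n" using reals_Archimedean2 by blast
    then have "x \<in> {- real n<..<real n}" by auto
    then obtain L M where "((\<lambda>x. Re (f x)) has_real_derivative L) (at x)"
        "((\<lambda>x. Im (f x)) has_real_derivative M) (at x)" using nx by blast
    then have "(f has_vector_derivative Complex L M) (at x)"
      unfolding has_vector_derivative_complex_iff by simp
    then have "(f has_vector_derivative vector_derivative f (at x)) (at x)"
      using vector_derivative_at by metis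
    then show False using x by blast
  qed
qed

section \<open>Integration by parts in the window space\<close>

text \<open>Integrability of \<open>f'\<close> is part of the conclusion, and the gauge integral
  delivers it. At tags off \<open>N\<close> the gauge makes increments close to their linearisation;
  at tags in \<open>N\<close> it confines the intervals to an open set of measure below \<delta>,
  where absolute continuity bounds the increments.\<close>

lemma abs_continuous_fundamental_theorem:
  assumes ac: "abs_continuous_on {a..b} f" and "a \<le> b" and N: "negligible N"
    and der: "\<And>x. x \<in> {a..b} - N \<Longrightarrow> (f has_vector_derivative f' x) (at x)"
  shows "(f' has_integral (f b - f a)) {a..b}"
proof -
  \<comment> \<open>With the value 0 on \<open>N\<close>, a tag in \<open>N\<close> adds nothing to
    the Riemann sum and its error is the bare increment of \<open>f\<close>. Changing values on
    \<open>N\<close> restores \<open>f'\<close> at the end.\<close>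
  define f0 where "f0 = (\<lambda>x. if x \<in> N then 0 else f' x)"
  have "(f0 has_integral (f b - f a)) {a..b}"
    unfolding has_integral_real
  proof (intro allI impI)
    fix e :: real assume "e > 0"
    \<comment> \<open>The summand 1 keeps the denominator positive when
      \<open>a = b\<close>.\<close>
    define e1 where "e1 = e / (2 * (b - a + 1))"
    have e1: "e1 > 0" "e1 * (b - a) < e / 2"
      using \<open>e > 0\<close> \<open>a \<le> b\<close> by (auto simp: e1_def field_simps)
    obtain \<delta> where \<delta>: "\<delta> > 0" "\<And>d. d division_of \<Union>d \<Longrightarrow> \<Union>d \<subseteq> {a..b} \<Longrightarrow>
        (\<Sum>k\<in>d. Sup k - Inf k) < \<delta> \<Longrightarrow> (\<Sum>k\<in>d. cmod (f (Sup k) - f (Inf k))) < e / 2"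
      using abs_continuous_onE[OF ac half_gt_zero[OF \<open>e > 0\<close>]] by blast
    have Nm: "N \<in> lmeasurable" "measure lebesgue N = 0"
      using N by (auto simp: negligible_imp_measurable negligible_imp_measure0)
    obtain T where T: "open T" "N \<subseteq> T" "T - N \<in> lmeasurable" "emeasure lebesgue (T - N) < ennreal \<delta>"
      using sets_lebesgue_outer_open[OF fmeasurableD[OF Nm(1)] \<delta>(1)] by blast
    have T': "T \<in> lmeasurable" "measure lebesgue T < \<delta>"
    proof -
      have eq: "T = (T - N) \<union> N" using T(2) by blast
      show "T \<in> lmeasurable" by (subst eq) (intro fmeasurable.Un T Nm)
      have "measure lebesgue T \<le> measure lebesgue (T - N) + measure lebesgue N"
        by (subst eq, rule measure_Un_le) (use T(3) Nm(1) in auto)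
      also have "\<dots> < \<delta>"
        using T(3,4) \<delta>(1) Nm(2) by (simp add: emeasure_eq_measure2 ennreal_less_iff)
      finally show "measure lebesgue T < \<delta>" .
    qed
    have "\<exists>d>0. (x \<in> N \<longrightarrow> ball x d \<subseteq> T) \<and> (x \<in> {a..b} - N \<longrightarrow>
        (\<forall>y. norm (y - x) < d \<longrightarrow> norm (f y - f x - (y - x) *\<^sub>R f' x) \<le> e1 * norm (y - x)))" for x
    proof (cases "x \<in> N")
      case True
      then show ?thesis using T(1,2) by (metis Diff_iff openE subsetD)
    next
      case False
      show ?thesis
      proof (cases "x \<in> {a..b}")
        case True
        with False der[of x] show ?thesis
          using e1(1) unfolding has_vector_derivative_def has_derivative_at_alt by blast
      next
        case out: False
        show ?thesis by (rule exI[of _ 1]) (use out False in auto)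
      qed
    qed
    then obtain d where d: "\<And>x. d x > 0" "\<And>x. x \<in> N \<Longrightarrow> ball x (d x) \<subseteq> T"
      "\<And>x y. x \<in> {a..b} - N \<Longrightarrow> norm (y - x) < d x \<Longrightarrow>
        norm (f y - f x - (y - x) *\<^sub>R f' x) \<le> e1 * norm (y - x)" by metis
    have "norm (sum (\<lambda>(x, k). measure lborel k *\<^sub>R f0 x) p - (f b - f a)) < e"
      if p: "p tagged_division_of {a..b}" and fine: "(\<lambda>x. ball x (d x)) fine p" for p
    proof -
      have finp: "finite p" using p by blast
      have K: "x \<in> K" "K \<subseteq> {a..b}" "\<exists>u v. K = {u..v}" "K \<subseteq> ball x (d x)" if "(x, K) \<in> p" for x K
        using tagged_division_ofD(2,3,4)[OF p that] fine that by (auto simp: fine_def)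
      define p' where "p' = {(x, K) \<in> p. x \<in> N}"
      \<comment> \<open>Regrouping a sum over tagged intervals by intervals requires a summand that
        vanishes on degenerate ones; for the empty interval this has to be prescribed, since
        \<open>Sup\<close> and \<open>Inf\<close> say nothing there.\<close>
      define \<Delta> where "\<Delta> K = (if K = {} then 0 else cmod (f (Sup K) - f (Inf K)))" for K
      have tp': "p' tagged_partial_division_of {a..b}"
        using p unfolding tagged_division_of_def
        by (rule_tac tagged_partial_division_subset[of p]) (auto simp: p'_def)
      have div: "snd ` p' division_of \<Union>(snd ` p')"
        using partial_division_of_tagged_division[OF tp'] .
      have "(\<Sum>k\<in>snd ` p'. Sup k - Inf k) \<le> measure lebesgue T"
        unfolding sum_lengths_division(1)[OF div]
      proof (rule measure_mono_fmeasurable)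
        show "\<Union>(snd ` p') \<subseteq> T" using K(4) d(2) by (fastforce simp: p'_def)
      qed (use sum_lengths_division(2)[OF div] T' in auto)
      then have len: "(\<Sum>k\<in>snd ` p'. Sup k - Inf k) < \<delta>" using T'(2) by simp
      have "(\<Sum>(x, K)\<in>p'. \<Delta> K) = (\<Sum>K\<in>snd ` p'. \<Delta> K)"
      proof (rule sum.over_tagged_division_lemma[OF tagged_partial_division_of_Union_self[OF tp']])
        fix u v :: real assume "box u v = {}"
        then have "cbox u v = {} \<or> u = v" by auto
        then show "\<Delta> (cbox u v) = 0" by (auto simp: \<Delta>_def)
      qed
      also have "\<dots> = (\<Sum>K\<in>snd ` p'. cmod (f (Sup K) - f (Inf K)))"
        using division_ofD(3)[OF div] by (intro sum.cong) (auto simp: \<Delta>_def)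
      also have "\<dots> < e / 2"
      proof (intro \<delta>(2) div len)
        show "\<Union>(snd ` p') \<subseteq> {a..b}" using K(2) unfolding p'_def by fastforce
      qed
      finally have small: "(\<Sum>(x, K)\<in>p'. \<Delta> K) < e / 2" .
      have ba: "b - a = (\<Sum>(x, K)\<in>p. Sup K - Inf K)" "f b - f a = (\<Sum>(x, K)\<in>p. f (Sup K) - f (Inf K))"
        using additive_tagged_division_1[OF \<open>a \<le> b\<close> p, of "\<lambda>x. x"]
          additive_tagged_division_1[OF \<open>a \<le> b\<close> p, of f] by auto
      have "norm (sum (\<lambda>(x, k). measure lborel k *\<^sub>R f0 x) p - (f b - f a))
          = norm (\<Sum>(x, K)\<in>p. measure lborel K *\<^sub>R f0 x - (f (Sup K) - f (Inf K)))"
        unfolding ba(2) by (simp add: sum_subtractf split_def)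
      also have "\<dots> \<le> (\<Sum>(x, K)\<in>p. e1 * (Sup K - Inf K) + (if x \<in> N then \<Delta> K else 0))"
      proof (rule sum_norm_le, safe)
        fix x K assume xK: "(x, K) \<in> p"
        obtain u v where uv: "K = {u..v}" using K(3)[OF xK] by blast
        have x: "u \<le> x" "x \<le> v" using K(1)[OF xK] uv by auto
        show "norm (measure lborel K *\<^sub>R f0 x - (f (Sup K) - f (Inf K)))
            \<le> e1 * (Sup K - Inf K) + (if x \<in> N then \<Delta> K else 0)"
        proof (cases "x \<in> N")
          case True
          then show ?thesis using x e1(1) uv by (auto simp: f0_def \<Delta>_def norm_minus_commute)
        next
          case False
          have xab: "x \<in> {a..b} - N" using K(1,2)[OF xK] False by blast
          have "{u, v} \<subseteq> ball x (d x)" using subsetD[OF K(4)[OF xK], of u] subsetD[OF K(4)[OF xK], of v] uv x by simp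
          then have "norm (f v - f x - (v - x) *\<^sub>R f' x) \<le> e1 * norm (v - x)"
            "norm (f u - f x - (u - x) *\<^sub>R f' x) \<le> e1 * norm (u - x)"
            using d(3)[OF xab, of v] d(3)[OF xab, of u] by (auto simp: dist_real_def abs_minus_commute)
          \<comment> \<open>The tag lies between the end points, so the distances
            \<open>v - x\<close> and \<open>x - u\<close> in the two error bounds add up to
            \<open>v - u\<close>.\<close>
          moreover have "(v - u) *\<^sub>R f' x - (f v - f u)
              = (f u - f x - (u - x) *\<^sub>R f' x) - (f v - f x - (v - x) *\<^sub>R f' x)"
            by (simp add: algebra_simps)
          then have "norm ((v - u) *\<^sub>R f' x - (f v - f u))
              \<le> norm (f u - f x - (u - x) *\<^sub>R f' x) + norm (f v - f x - (v - x) *\<^sub>R f' x)"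
            by (metis norm_triangle_ineq4)
          ultimately have "norm ((v - u) *\<^sub>R f' x - (f v - f u)) \<le> e1 * (v - u)"
            using x by (simp add: algebra_simps)
          then show ?thesis using False x uv by (simp add: f0_def)
        qed
      qed
      also have "\<dots> = e1 * (b - a) + (\<Sum>(x, K)\<in>p. if x \<in> N then \<Delta> K else 0)"
        unfolding ba(1) by (simp add: split_def sum.distrib sum_distrib_left)
      also have "(\<Sum>(x, K)\<in>p. if x \<in> N then \<Delta> K else 0) = (\<Sum>(x, K)\<in>p'. \<Delta> K)"
        unfolding p'_def split_def using finp by (simp add: sum.If_cases Int_def)
      also have "e1 * (b - a) + (\<Sum>(x, K)\<in>p'. \<Delta> K) < e" using small e1(2) by simp
      finally show ?thesis .
    qed
    moreover have "gauge (\<lambda>x. ball x (d x))" using d(1) by (rule gauge_ball_dependent[rule_format])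
    ultimately show "\<exists>\<gamma>. gauge \<gamma> \<and> (\<forall>\<D>. \<D> tagged_division_of {a..b} \<and> \<gamma> fine \<D> \<longrightarrow>
        norm (sum (\<lambda>(x, k). measure lborel k *\<^sub>R f0 x) \<D> - (f b - f a)) < e)" by blast
  qed
  then show ?thesis
    by (rule has_integral_spike[OF N, rotated]) (simp add: f0_def)
qed

section \<open>Weighted integrals on the window axis\<close>

lemma borel_measurable_window_space [simp]:
  "borel_measurable window_space = borel_measurable lebesgue"
  unfolding window_space_def by (rule measurable_cong_sets) auto

lemma integral_window_space:
  fixes g :: "real \<Rightarrow> 'a::{banach, second_countable_topology}"
  assumes "g \<in> borel_measurable lebesgue"
  shows "integrable window_space g \<longleftrightarrow> integrable lebesgue (\<lambda>x. (1 / \<bar>x\<bar>) *\<^sub>R g x)"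
    "integral\<^sup>L window_space g = (\<integral>x. (1 / \<bar>x\<bar>) *\<^sub>R g x \<partial>lebesgue)"
proof -
  have w: "(\<lambda>x::real. 1 / \<bar>x\<bar>) \<in> borel_measurable lebesgue"
    by (intro measurable_completion) simp
  show "integrable window_space g \<longleftrightarrow> integrable lebesgue (\<lambda>x. (1 / \<bar>x\<bar>) *\<^sub>R g x)"
    unfolding window_space_def by (rule integrable_density[OF assms w]) simp
  show "integral\<^sup>L window_space g = (\<integral>x. (1 / \<bar>x\<bar>) *\<^sub>R g x \<partial>lebesgue)"
    unfolding window_space_def by (rule integral_density[OF assms w]) simp
qed

lemma integrable_L2_mult_cnj:
  assumes f: "f \<in> L2 M" and g: "g \<in> L2 M"
  shows "integrable M (\<lambda>x. f x * cnj (g x))"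
proof (rule Bochner_Integration.integrable_bound)
  have [measurable]: "f \<in> borel_measurable M" "g \<in> borel_measurable M"
    using f g by (auto simp: L2_def)
  show "(\<lambda>x. f x * cnj (g x)) \<in> borel_measurable M"
    by (intro borel_measurable_times borel_measurable_continuous_on[of cnj g M]) (auto intro: continuous_intros)
  show "integrable M (\<lambda>x. (cmod (f x))\<^sup>2 + (cmod (g x))\<^sup>2)"
    using f g by (auto simp: L2_def)
  have "a * b \<le> a\<^sup>2 + b\<^sup>2" if "0 \<le> a" "0 \<le> b" for a b :: real
    using sum_squares_bound[of a b] mult_nonneg_nonneg[OF that] by linarith
  then show "AE x in M. norm (f x * cnj (g x)) \<le> norm ((cmod (f x))\<^sup>2 + (cmod (g x))\<^sup>2)"
    by (simp add: norm_mult)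
qed

text \<open>Otherwise \<open>c / \<bar>x\<bar>\<close>, whose integral over the interval is \<open>c * K\<close>, would be a lower bound for \<open>h x / \<bar>x\<bar>\<close>.\<close>

lemma small_value_on_log_interval:
  fixes h :: "real \<Rightarrow> real"
  assumes int: "integrable lebesgue (\<lambda>x. h x / \<bar>x\<bar>)" and nonneg: "\<And>x. h x \<ge> 0"
    and "c > 0" and K: "(\<integral>x. h x / \<bar>x\<bar> \<partial>lebesgue) < c * K" and "a > 0"
  shows "\<exists>x\<in>{a..a * exp K}. h x < c" "\<exists>x\<in>{- (a * exp K)..- a}. h x < c"
proof -
  let ?b = "a * exp K"
  have "(\<integral>x. h x / \<bar>x\<bar> \<partial>lebesgue) \<ge> 0" by (intro Bochner_Integration.integral_nonneg) (simp add: nonneg)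
  with K \<open>c > 0\<close> have "K > 0" by (metis le_less_trans zero_less_mult_pos)
  then have ab: "a < ?b" using \<open>a > 0\<close> by simp
  have ex: "\<exists>x\<in>S. h x < c" if S: "((\<lambda>x. 1 / \<bar>x\<bar>) has_integral K) S" for S
  proof (rule ccontr)
    assume "\<not> (\<exists>x\<in>S. h x < c)"
    then have le: "c \<le> h x" if "x \<in> S" for x using that by (auto simp: not_less)
    have "((\<lambda>x. c * (1 / \<bar>x\<bar>)) has_integral c * K) S" by (rule has_integral_mult_right[OF S])
    then have "((\<lambda>x. if x \<in> S then c * (1 / \<bar>x\<bar>) else 0) has_integral c * K) UNIV"
      by (simp only: has_integral_restrict_UNIV)
    moreover have "((\<lambda>x. h x / \<bar>x\<bar>) has_integral (\<integral>x. h x / \<bar>x\<bar> \<partial>lebesgue)) UNIV"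
      by (rule has_integral_integral_lebesgue[OF int])
    ultimately have "c * K \<le> (\<integral>x. h x / \<bar>x\<bar> \<partial>lebesgue)"
      by (rule has_integral_le) (auto intro!: divide_right_mono le simp: nonneg)
    with K show False by simp
  qed
  have "((\<lambda>x. 1 / x) has_integral (ln ?b - ln a)) {a..?b}"
    using ab \<open>a > 0\<close>
    by (intro fundamental_theorem_of_calculus)
      (auto intro!: derivative_eq_intros simp flip: has_real_derivative_iff_has_vector_derivative)
  then have "((\<lambda>x. 1 / \<bar>x\<bar>) has_integral K) {a..?b}"
    using \<open>a > 0\<close> by (subst (asm) has_integral_cong[of _ _ "\<lambda>x. 1 / \<bar>x\<bar>"]) (auto simp: ln_mult)
  then show "\<exists>x\<in>{a..?b}. h x < c" by (rule ex)
  have "((\<lambda>x. 1 / (- x)) has_integral ((\<lambda>x. - ln (- x)) (- a) - (\<lambda>x. - ln (- x)) (- ?b))) {- ?b..- a}"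
    using ab \<open>a > 0\<close>
    by (intro fundamental_theorem_of_calculus)
      (auto intro!: derivative_eq_intros simp flip: has_real_derivative_iff_has_vector_derivative)
  then have "((\<lambda>x. 1 / \<bar>x\<bar>) has_integral K) {- ?b..- a}"
    using \<open>a > 0\<close> by (subst (asm) has_integral_cong[of _ _ "\<lambda>x. 1 / \<bar>x\<bar>"]) (auto simp: ln_mult)
  then show "\<exists>x\<in>{- ?b..- a}. h x < c" by (rule ex)
qed

text \<open>
  The boundary terms of the integration by parts vanish along suitable sequences of end points:
  \<open>\<bar>f\<bar>\<^sup>2 / \<bar>\<omega>'\<bar>\<close> is integrable while \<open>1 / \<bar>\<omega>'\<bar>\<close> is integrable neither at \<open>0\<close> nor at infinity.
\<close>

lemma dilation_mean_real:
  assumes f: "f \<in> Dom_W"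
  defines "e \<equiv> op_mean window_space (diff_op (\<lambda>\<omega>'. \<i> * of_real \<omega>')) f"
  shows "cnj e = e"
proof -
  define f' where "f' = (\<lambda>x. vector_derivative f (at x))"
  have f2: "f \<in> L2 window_space" "diff_op (\<lambda>\<omega>'. of_real \<omega>') f \<in> L2 window_space"
    and lac: "locally_abs_continuous f" using f by (auto simp: Dom_W_def)
  have fm: "f \<in> borel_measurable lebesgue" using f2(1) by (simp add: L2_def)
  obtain N where N: "negligible N" "\<And>x. x \<notin> N \<Longrightarrow> (f has_vector_derivative f' x) (at x)"
    using locally_abs_continuous_differentiable_ae[OF lac]
    unfolding completion.AE_iff_null_sets f'_def negligible_iff_null_sets by auto
  define u where "u = (\<lambda>x. (1 / \<bar>x\<bar>) *\<^sub>R (of_real x * f' x * cnj (f x)))"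
  have int_d: "integrable window_space (\<lambda>x. of_real x * f' x * cnj (f x))"
    using integrable_L2_mult_cnj[OF f2(2,1)] by (simp add: diff_op_def f'_def)
  then have meas_d: "(\<lambda>x. of_real x * f' x * cnj (f x)) \<in> borel_measurable lebesgue"
    using borel_measurable_integrable by fastforce
  have u: "integrable lebesgue u"
    using int_d unfolding integral_window_space(1)[OF meas_d] u_def .
  have "e = \<i> * (\<integral>x. of_real x * f' x * cnj (f x) \<partial>window_space)"
    unfolding e_def op_mean_def L2_inner_def diff_op_def f'_def
    by (simp add: mult.assoc flip: integral_mult_right_zero)
  also have "(\<integral>x. of_real x * f' x * cnj (f x) \<partial>window_space) = integral\<^sup>L lebesgue u"
    unfolding integral_window_space(2)[OF meas_d] u_def ..
  finally have e: "e = \<i> * integral\<^sup>L lebesgue u" .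
  \<comment> \<open>Since \<open>e\<close> is \<i> times the integral of \<open>u\<close>, reality
    of \<open>e\<close> means that the integral of \<open>G\<close>, twice the real part of
    \<open>u\<close>, vanishes. The factor \<open>x\<close> cancels the weight up to sign, so
    \<open>G\<close> is almost everywhere \<open>sgn x\<close> times the derivative of the squared
    modulus of \<open>f\<close>.\<close>
  define G where "G = (\<lambda>x. u x + cnj (u x))"
  have G: "integrable lebesgue G"
    unfolding G_def using u by (simp add: integrable_cnj)
  define h where "h = (\<lambda>x. (cmod (f x))\<^sup>2)"
  have h_nonneg: "h x \<ge> 0" for x by (simp add: h_def)
  have hm: "h \<in> borel_measurable lebesgue" unfolding h_def using fm by simp
  have "integrable window_space h" using f2(1) by (simp add: L2_def h_def)
  then have hW: "integrable lebesgue (\<lambda>x. h x / \<bar>x\<bar>)"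
    unfolding integral_window_space(1)[OF hm] by simp
  have FTC: "((\<lambda>x. f' x * cnj (f x) + f x * cnj (f' x)) has_integral
      (of_real (h b) - of_real (h a))) {a..b}" if "a \<le> b" for a b
  proof -
    have "locally_abs_continuous (\<lambda>x. f x * cnj (f x))"
      by (intro locally_abs_continuous_mult locally_abs_continuous_cnj lac)
    then have ac: "abs_continuous_on {a..b} (\<lambda>x. f x * cnj (f x))"
      unfolding locally_abs_continuous_def by blast
    have "((\<lambda>x. f x * cnj (f' x) + f' x * cnj (f x)) has_integral
        (f b * cnj (f b) - f a * cnj (f a))) {a..b}"
    proof (rule abs_continuous_fundamental_theorem[OF ac that N(1)])
      fix x assume "x \<in> {a..b} - N"
      then have "(f has_vector_derivative f' x) (at x)" using N(2) by blast
      then show "((\<lambda>x. f x * cnj (f x)) has_vector_derivative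
          (f x * cnj (f' x) + f' x * cnj (f x))) (at x)"
        by (intro has_vector_derivative_mult has_vector_derivative_cnj)
    qed
    then show ?thesis by (simp add: h_def complex_norm_square[symmetric] add.commute)
  qed
  have sgn_u: "u x = sgn x *\<^sub>R (f' x * cnj (f x))" for x
    by (simp add: u_def scaleR_conv_of_real sgn_real_def)
  have Gpos: "(G has_integral (of_real (h b) - of_real (h a))) {a..b}" if "0 < a" "a \<le> b" for a b
    using FTC[OF that(2)] that(1)
    by (subst has_integral_cong[of _ _ "\<lambda>x. f' x * cnj (f x) + f x * cnj (f' x)"])
      (auto simp: G_def sgn_u mult.commute)
  have Gneg: "(G has_integral - (of_real (h b) - of_real (h a))) {a..b}" if "b < 0" "a \<le> b" for a b
    using has_integral_neg[OF FTC[OF that(2)]] that(1)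
    by (subst has_integral_cong[of _ _ "\<lambda>x. - (f' x * cnj (f x) + f x * cnj (f' x))"])
      (auto simp: G_def sgn_u mult.commute)
  define C where "C = (\<integral>x. h x / \<bar>x\<bar> \<partial>lebesgue)"
  have "\<exists>r R r' R'. 0 < r \<and> r \<le> inverse (real (Suc n)) \<and> real (Suc n) \<le> R \<and> h r < inverse (real (Suc n)) \<and> h R < inverse (real (Suc n)) \<and>
      0 < r' \<and> r' \<le> inverse (real (Suc n)) \<and> real (Suc n) \<le> R' \<and> h (- r') < inverse (real (Suc n)) \<and> h (- R') < inverse (real (Suc n))"
    (is "\<exists>r R r' R'. ?P n r R r' R'") for n
  proof -
    define c where "c = inverse (real (Suc n))"
    \<comment> \<open>This makes \<open>c * K = C + 1\<close>, just above the integral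
      \<open>C\<close>.\<close>
    define K where "K = (C + 1) / c"
    have c: "c > 0" "C < c * K" by (auto simp: c_def K_def)
    note * = small_value_on_log_interval[OF hW h_nonneg c(1) c(2)[unfolded C_def]]
    have p1: "exp (- K) * c > 0" and p2: "real (Suc n) > 0" using c by auto
    \<comment> \<open>Starting at \<open>exp (- K) * c\<close>, the logarithmic interval ends
      exactly at \<open>c\<close>, so a point near 0 is found; for the points near infinity the
      interval starts at \<open>Suc n\<close>.\<close>
    obtain r r' where r: "r \<in> {exp (- K) * c..c}" "h r < c" "r' \<in> {- c..- (exp (- K) * c)}" "h r' < c"
    proof -
      have "exp (- K) * c * exp K = c" by (simp add: exp_minus)
      then show ?thesis using *[OF p1] that by metis
    qed
    obtain R R' where R: "R \<in> {real (Suc n)..real (Suc n) * exp K}" "h R < c"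
        "R' \<in> {- (real (Suc n) * exp K)..- real (Suc n)}" "h R' < c"
      using *[OF p2] by auto
    have "0 < r" "0 < - r'" using r p1 by auto
    then have "?P n r R (- r') (- R')" using r R unfolding c_def[symmetric] by auto
    then show ?thesis by blast
  qed
  then obtain r R r' R' where rR: "\<And>n. ?P n (r n) (R n) (r' n) (R' n)" by metis
  \<comment> \<open>The two half-lines are kept apart because \<open>sgn\<close> changes at 0. Every
    nonzero point belongs to \<open>S n\<close> for all large \<open>n\<close>.\<close>
  define S where "S n = {r n..R n} \<union> {- R' n..- r' n}" for n
  define G' where "G' n x = (if x \<in> S n then G x else 0)" for n x
  have small1: "inverse (real (Suc n)) \<le> 1" for n by (simp add: field_simps)
  have GS: "(G has_integral of_real (h (R n) - h (r n) + (h (- R' n) - h (- r' n)))) (S n)" for n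
  proof -
    have le: "r n \<le> R n" "- R' n \<le> - r' n" "0 < r n" "- r' n < 0"
      using rR[of n] small1[of n] by auto
    have "(G has_integral (of_real (h (R n)) - of_real (h (r n))
        + - (of_real (h (- r' n)) - of_real (h (- R' n))))) (S n)"
      unfolding S_def
      by (intro has_integral_Un Gpos Gneg le) (use le in \<open>auto intro: negligible_subset[of "{}"]\<close>)
    then show ?thesis by simp
  qed
  have G'int: "integral\<^sup>L lebesgue (G' n) = of_real (h (R n) - h (r n) + (h (- R' n) - h (- r' n)))" for n
  proof -
    have "integrable lebesgue (\<lambda>x. indicator (S n) x *\<^sub>R G x)"
      by (intro integrable_mult_indicator G) (auto simp: S_def)
    moreover have "(\<lambda>x. indicator (S n) x *\<^sub>R G x) = G' n" by (auto simp: G'_def)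
    ultimately have "(G' n has_integral integral\<^sup>L lebesgue (G' n)) UNIV"
      using has_integral_integral_lebesgue by metis
    moreover have "(G' n has_integral of_real (h (R n) - h (r n) + (h (- R' n) - h (- r' n)))) UNIV"
      using GS[of n] unfolding G'_def has_integral_restrict_UNIV .
    ultimately show ?thesis by (rule has_integral_unique)
  qed
  have inv: "(\<lambda>n. inverse (real (Suc n))) \<longlonglongrightarrow> 0" by (rule LIMSEQ_inverse_real_of_nat)
  have "(\<lambda>n. integral\<^sup>L lebesgue (G' n)) \<longlonglongrightarrow> integral\<^sup>L lebesgue G"
  proof (rule integral_dominated_convergence)
    show "G \<in> borel_measurable lebesgue" using G by simp
    show "G' n \<in> borel_measurable lebesgue" for n
      unfolding G'_def using G by (intro measurable_If_set) (auto simp: S_def)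
    show "integrable lebesgue (\<lambda>x. norm (G x))" using G by simp
    show "AE x in lebesgue. norm (G' n x) \<le> norm (G x)" for n
      by (simp add: G'_def)
    \<comment> \<open>The convention \<open>1 / 0 = 0\<close> gives \<open>G\<close> the value 0 at
      the origin, so convergence holds there as well.\<close>
    have "G 0 = 0" by (simp add: G_def u_def)
    have "(\<lambda>n. G' n x) \<longlonglongrightarrow> G x" for x
    proof (cases "x = 0")
      case True
      have "G' n x = G x" for n using \<open>G 0 = 0\<close> True by (simp add: G'_def)
      then show ?thesis by simp
    next
      case False
      have "\<forall>\<^sub>F n in sequentially. inverse (real (Suc n)) < \<bar>x\<bar>"
        using False by (intro order_tendstoD(2)[OF inv]) simp
      moreover have "\<forall>\<^sub>F n in sequentially. \<bar>x\<bar> < real (Suc n)"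
      proof -
        obtain m where "\<bar>x\<bar> < real m" using reals_Archimedean2 by blast
        then show ?thesis by (intro eventually_sequentiallyI[of m]) simp
      qed
      ultimately have "\<forall>\<^sub>F n in sequentially. G' n x = G x"
      proof eventually_elim
        case (elim n)
        then have "x \<in> S n" using rR[of n] False unfolding S_def by (cases "x > 0") auto
        then show ?case by (simp add: G'_def)
      qed
      then show ?thesis by (rule tendsto_eventually)
    qed
    then show "AE x in lebesgue. (\<lambda>n. G' n x) \<longlonglongrightarrow> G x" by simp
  qed
  moreover have "(\<lambda>n. integral\<^sup>L lebesgue (G' n)) \<longlonglongrightarrow> 0"
  proof (rule Lim_null_comparison)
    \<comment> \<open>Four nonnegative values below \<open>1 / (n + 1)\<close> enter, two with each
      sign.\<close>
    have "norm (integral\<^sup>L lebesgue (G' n)) \<le> 2 * inverse (real (Suc n))" for n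
      using rR[of n] h_nonneg[of "r n"] h_nonneg[of "R n"] h_nonneg[of "- r' n"] h_nonneg[of "- R' n"]
      unfolding G'int norm_of_real by linarith
    then show "\<forall>\<^sub>F n in sequentially. norm (integral\<^sup>L lebesgue (G' n)) \<le> 2 * inverse (real (Suc n))"
      by simp
    show "(\<lambda>n. 2 * inverse (real (Suc n))) \<longlonglongrightarrow> 0"
      using tendsto_mult_right_zero[OF inv] .
  qed
  ultimately have "integral\<^sup>L lebesgue G = 0" by (rule LIMSEQ_unique)
  moreover have "integral\<^sup>L lebesgue G = integral\<^sup>L lebesgue u + cnj (integral\<^sup>L lebesgue u)"
    unfolding G_def using u by (simp add: integrable_cnj)
  ultimately have "cnj (integral\<^sup>L lebesgue u) = - integral\<^sup>L lebesgue u"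
    by (simp add: eq_neg_iff_add_eq_0 add.commute)
  then show "cnj e = e" by (simp add: e)
qed

section \<open>Simple functions\<close>

lemma null_sets_lborel_Times:
  fixes N :: "real set"
  assumes N: "N \<in> null_sets lborel"
  shows "N \<times> (UNIV :: real set) \<in> null_sets lborel" "(UNIV :: real set) \<times> N \<in> null_sets lborel"
proof -
  have "N \<times> (UNIV :: real set) \<in> sets (lborel \<Otimes>\<^sub>M lborel)"
    "(UNIV :: real set) \<times> N \<in> sets (lborel \<Otimes>\<^sub>M lborel)"
    using null_setsD2[OF N] by (auto intro: pair_measureI)
  moreover have "emeasure (lborel \<Otimes>\<^sub>M lborel) (N \<times> (UNIV :: real set)) = 0"
    "emeasure (lborel \<Otimes>\<^sub>M lborel) ((UNIV :: real set) \<times> N) = 0"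
    using null_setsD1[OF N] null_setsD2[OF N] by (simp_all add: lborel.emeasure_pair_measure_Times)
  ultimately show "N \<times> (UNIV :: real set) \<in> null_sets lborel" "(UNIV :: real set) \<times> N \<in> null_sets lborel"
    unfolding null_sets_def lborel_prod by simp_all
qed

lemma null_sets_lborel_vimage:
  assumes N: "N \<in> null_sets lborel"
  shows "fst -` N \<in> null_sets (lborel :: (real \<times> real) measure)"
    "snd -` N \<in> null_sets (lborel :: (real \<times> real) measure)"
proof -
  have "fst -` N = N \<times> (UNIV :: real set)" "snd -` N = (UNIV :: real set) \<times> N" by auto
  then show "fst -` N \<in> null_sets (lborel :: (real \<times> real) measure)"
    "snd -` N \<in> null_sets (lborel :: (real \<times> real) measure)"
    using null_sets_lborel_Times[OF N] by simp_all
qed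

text \<open>Borel measurability of a projection extends to the completed measures once preimages of
  null sets are null; here these preimages are strips over a null set.\<close>

lemma lebesgue_measurable_fst_snd:
  "fst \<in> (lebesgue :: (real \<times> real) measure) \<rightarrow>\<^sub>M lebesgue"
  "snd \<in> (lebesgue :: (real \<times> real) measure) \<rightarrow>\<^sub>M lebesgue"
proof -
  have m: "fst \<in> (lebesgue :: (real \<times> real) measure) \<rightarrow>\<^sub>M lborel"
    "snd \<in> (lebesgue :: (real \<times> real) measure) \<rightarrow>\<^sub>M lborel"
    by (auto intro!: measurable_completion simp: borel_prod[symmetric])
  have borel: "N \<in> sets borel" if "N \<in> null_sets lborel" for N :: "real set"
    using null_setsD2[OF that] by simp
  have "null_sets lborel \<subseteq> null_sets (distr (lebesgue :: (real \<times> real) measure) lborel fst)"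
    "null_sets lborel \<subseteq> null_sets (distr (lebesgue :: (real \<times> real) measure) lborel snd)"
    using m borel by (auto simp: null_sets_distr_iff
        intro!: null_sets_completionI null_sets_lborel_vimage)
  with m show "fst \<in> (lebesgue :: (real \<times> real) measure) \<rightarrow>\<^sub>M lebesgue"
    "snd \<in> (lebesgue :: (real \<times> real) measure) \<rightarrow>\<^sub>M lebesgue"
    by (auto intro: completion.measurable_completion2)
qed

lemma AE_lebesgue_fst_snd:
  assumes "AE x in lebesgue. P x"
  shows "AE z in (lebesgue :: (real \<times> real) measure). P (fst z)"
    "AE z in (lebesgue :: (real \<times> real) measure). P (snd z)"
proof -
  have "AE x in lborel. P x" using assms by (simp add: AE_completion_iff)
  then obtain N where N: "N \<in> null_sets lborel" "{x. \<not> P x} \<subseteq> N"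
    by (auto simp: eventually_ae_filter)
  have "AE z in (lborel :: (real \<times> real) measure). P (fst z)"
    by (rule AE_I'[OF null_sets_lborel_vimage(1)[OF N(1)]]) (use N(2) in auto)
  then show "AE z in (lebesgue :: (real \<times> real) measure). P (fst z)" by (rule AE_completion)
  have "AE z in (lborel :: (real \<times> real) measure). P (snd z)"
    by (rule AE_I'[OF null_sets_lborel_vimage(2)[OF N(1)]]) (use N(2) in auto)
  then show "AE z in (lebesgue :: (real \<times> real) measure). P (snd z)" by (rule AE_completion)
qed

text \<open>Fubini's theorem is applied to the product of the two Borel measures, whereas Lebesgue
  measure on the plane is the completion of that product. Borel representatives bridge the
  difference.\<close>

lemma integrable_lebesgue_imp_lborel:
  fixes \<phi> :: "real \<Rightarrow> complex"
  assumes \<phi>: "integrable lebesgue \<phi>"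
  obtains \<phi>' where "integrable lborel \<phi>'" "AE x in lebesgue. \<phi> x = \<phi>' x"
    "integral\<^sup>L lebesgue \<phi> = integral\<^sup>L lborel \<phi>'"
proof -
  have m: "\<phi> \<in> borel_measurable lebesgue" using \<phi> by simp
  obtain r where r: "r \<in> borel_measurable lborel" "AE x in lborel. Re (\<phi> x) = r x"
    using completion_ex_borel_measurable_real[of "\<lambda>x. Re (\<phi> x)" lborel] m by auto
  obtain i where i: "i \<in> borel_measurable lborel" "AE x in lborel. Im (\<phi> x) = i x"
    using completion_ex_borel_measurable_real[of "\<lambda>x. Im (\<phi> x)" lborel] m by auto
  define \<phi>' where "\<phi>' = (\<lambda>x. complex_of_real (r x) + \<i> * complex_of_real (i x))"
  have m': "\<phi>' \<in> borel_measurable lborel" unfolding \<phi>'_def using r(1) i(1) by simp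
  have "AE x in lborel. \<phi> x = \<phi>' x"
    using r(2) i(2) by eventually_elim (auto simp: \<phi>'_def complex_eq_iff)
  then have ae: "AE x in lebesgue. \<phi> x = \<phi>' x" by (rule AE_completion)
  have "integrable lebesgue \<phi>'"
    using \<phi> ae m measurable_completion[OF m'] by (subst integrable_cong_AE[of _ _ \<phi>]) auto
  then have "integrable lborel \<phi>'" using m' by (simp add: integrable_completion)
  moreover have "integral\<^sup>L lebesgue \<phi> = integral\<^sup>L lborel \<phi>'"
    using integral_cong_AE[OF m measurable_completion[OF m'] ae] integral_completion[OF m'] by simp
  ultimately show ?thesis using ae by (intro that)
qed

text \<open>Fubini's theorem holds for the Borel representatives, and their product agrees with the
  given one almost everywhere on the plane because null sets of either variable lift to null
  strips.\<close>

lemma lebesgue_integral_tensor: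
  fixes \<phi> \<psi> :: "real \<Rightarrow> complex"
  assumes \<phi>: "integrable lebesgue \<phi>" and \<psi>: "integrable lebesgue \<psi>"
  shows "integrable lebesgue (\<lambda>z. \<phi> (fst z) * \<psi> (snd z))"
    "(\<integral>z. \<phi> (fst z) * \<psi> (snd z) \<partial>lebesgue) = integral\<^sup>L lebesgue \<phi> * integral\<^sup>L lebesgue \<psi>"
proof -
  obtain \<phi>' where \<phi>': "integrable lborel \<phi>'" "AE x in lebesgue. \<phi> x = \<phi>' x"
    "integral\<^sup>L lebesgue \<phi> = integral\<^sup>L lborel \<phi>'" by (rule integrable_lebesgue_imp_lborel[OF \<phi>])
  obtain \<psi>' where \<psi>': "integrable lborel \<psi>'" "AE x in lebesgue. \<psi> x = \<psi>' x"
    "integral\<^sup>L lebesgue \<psi> = integral\<^sup>L lborel \<psi>'" by (rule integrable_lebesgue_imp_lborel[OF \<psi>])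
  let ?F = "\<lambda>z. \<phi> (fst z) * \<psi> (snd z)" and ?F' = "\<lambda>z. \<phi>' (fst z) * \<psi>' (snd z)"
  have [measurable]: "\<phi>' \<in> borel_measurable lborel" "\<psi>' \<in> borel_measurable lborel"
    using \<phi>'(1) \<psi>'(1) by auto
  have F'm: "?F' \<in> borel_measurable (lborel \<Otimes>\<^sub>M lborel)" by measurable
  have int: "integrable (lborel \<Otimes>\<^sub>M lborel) ?F'"
  proof (rule lborel_pair.Fubini_integrable[OF F'm])
    show "integrable lborel (\<lambda>x. \<integral>y. norm (?F' (x, y)) \<partial>lborel)"
      using \<phi>'(1) by (simp add: norm_mult)
    show "AE x in lborel. integrable lborel (\<lambda>y. ?F' (x, y))"
      using \<psi>'(1) by simp
  qed
  have "integral\<^sup>L (lborel \<Otimes>\<^sub>M lborel) ?F' = (\<integral>x. \<integral>y. ?F' (x, y) \<partial>lborel \<partial>lborel)"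
    by (rule lborel_pair.integral_fst'[OF int, symmetric])
  also have "\<dots> = integral\<^sup>L lborel \<phi>' * integral\<^sup>L lborel \<psi>'" by simp
  finally have val: "integral\<^sup>L lborel ?F' = integral\<^sup>L lebesgue \<phi> * integral\<^sup>L lebesgue \<psi>"
    by (simp add: lborel_prod \<phi>'(3) \<psi>'(3))
  have F'm: "?F' \<in> borel_measurable lborel" using F'm by (simp add: lborel_prod)
  have Fm: "?F \<in> borel_measurable lebesgue"
    using \<phi> \<psi>
    by (intro borel_measurable_times measurable_compose[OF lebesgue_measurable_fst_snd(1)]
        measurable_compose[OF lebesgue_measurable_fst_snd(2)] borel_measurable_integrable)
  have ae: "AE z in lebesgue. ?F z = ?F' z"
    using AE_lebesgue_fst_snd(1)[OF \<phi>'(2)] AE_lebesgue_fst_snd(2)[OF \<psi>'(2)]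
    by eventually_elim simp
  have F'l: "?F' \<in> borel_measurable lebesgue" by (rule measurable_completion[OF F'm])
  have "integrable lebesgue ?F'"
    using int F'm by (simp add: integrable_completion lborel_prod)
  then show "integrable lebesgue ?F"
    using ae by (subst integrable_cong_AE[OF Fm F'l]) auto
  show "integral\<^sup>L lebesgue ?F = integral\<^sup>L lebesgue \<phi> * integral\<^sup>L lebesgue \<psi>"
    using integral_cong_AE[OF Fm F'l ae] integral_completion[OF F'm] val by simp
qed

section \<open>Weighted integrals on the window-signal plane\<close>

lemma borel_measurable_window_signal_space [simp]:
  "borel_measurable window_signal_space = borel_measurable lebesgue"
  unfolding window_signal_space_def by (rule measurable_cong_sets) auto

lemma window_signal_space_eq:
  "window_signal_space = density lebesgue (\<lambda>z. ennreal (1 / \<bar>fst z\<bar>))"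
  unfolding window_signal_space_def by (simp add: split_def)

lemma measurable_window_weight: "(\<lambda>z::real \<times> real. 1 / \<bar>fst z\<bar>) \<in> borel_measurable lebesgue"
  by (rule measurable_completion) (simp add: borel_prod[symmetric])

lemma integral_window_signal_space:
  fixes g :: "real \<times> real \<Rightarrow> 'a::{banach, second_countable_topology}"
  assumes "g \<in> borel_measurable lebesgue"
  shows "integrable window_signal_space g \<longleftrightarrow> integrable lebesgue (\<lambda>z. (1 / \<bar>fst z\<bar>) *\<^sub>R g z)"
    "integral\<^sup>L window_signal_space g = (\<integral>z. (1 / \<bar>fst z\<bar>) *\<^sub>R g z \<partial>lebesgue)"
  unfolding window_signal_space_eq
  by (rule integrable_density[OF assms measurable_window_weight], simp)
    (rule integral_density[OF assms measurable_window_weight], simp)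

lemma AE_window_signal_space:
  assumes "AE z in lebesgue. P z"
  shows "AE z in window_signal_space. P z"
  using assms measurable_window_weight unfolding window_signal_space_eq
  by (subst AE_density) auto

text \<open>The weight depends on the window variable alone and is absorbed into the window factor,
  after which the integral factorises. The window arguments change places on the right because a
  simple function conjugates its window.\<close>

lemma simple_fun_inner:
  assumes \<phi>: "\<phi>1 \<in> L2 window_space" "\<phi>2 \<in> L2 window_space"
    and \<psi>: "\<psi>1 \<in> L2 signal_space" "\<psi>2 \<in> L2 signal_space"
  shows "integrable window_signal_space (\<lambda>z. simple_fun \<phi>1 \<psi>1 z * cnj (simple_fun \<phi>2 \<psi>2 z))"
    "L2_inner window_signal_space (simple_fun \<phi>1 \<psi>1) (simple_fun \<phi>2 \<psi>2)
      = L2_inner window_space \<phi>2 \<phi>1 * L2_inner signal_space \<psi>1 \<psi>2"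
    "simple_fun \<phi>1 \<psi>1 \<in> borel_measurable lebesgue"
proof -
  have meas: "simple_fun \<phi> \<psi> \<in> borel_measurable lebesgue"
    if "\<phi> \<in> L2 window_space" "\<psi> \<in> L2 signal_space" for \<phi> \<psi>
  proof -
    have "\<phi> \<in> borel_measurable lebesgue" "\<psi> \<in> borel_measurable lebesgue"
      using that by (auto simp: L2_def signal_space_def)
    then have "(\<lambda>x. cnj (\<phi> x)) \<in> borel_measurable lebesgue" "\<psi> \<in> borel_measurable lebesgue"
      by (auto intro: borel_measurable_continuous_on[of cnj] continuous_intros)
    then have "(\<lambda>z. cnj (\<phi> (fst z)) * \<psi> (snd z)) \<in> borel_measurable lebesgue"
      by (intro borel_measurable_times measurable_compose[OF lebesgue_measurable_fst_snd(1), of "\<lambda>x. cnj (\<phi> x)"]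
          measurable_compose[OF lebesgue_measurable_fst_snd(2), of \<psi>])
    then show ?thesis by (simp add: simple_fun_def split_def)
  qed
  show "simple_fun \<phi>1 \<psi>1 \<in> borel_measurable lebesgue" by (intro meas \<phi> \<psi>)
  let ?F = "\<lambda>z. simple_fun \<phi>1 \<psi>1 z * cnj (simple_fun \<phi>2 \<psi>2 z)"
  have "(\<lambda>z. cnj (simple_fun \<phi>2 \<psi>2 z)) \<in> borel_measurable lebesgue"
    by (rule borel_measurable_continuous_on[of cnj]) (auto intro: meas \<phi> \<psi> continuous_intros)
  then have Fm: "?F \<in> borel_measurable lebesgue"
    by (intro borel_measurable_times meas \<phi> \<psi>)
  let ?\<phi> = "\<lambda>x. (1 / \<bar>x\<bar>) *\<^sub>R (\<phi>2 x * cnj (\<phi>1 x))" and ?\<psi> = "\<lambda>y. \<psi>1 y * cnj (\<psi>2 y)"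
  have i\<phi>: "integrable window_space (\<lambda>x. \<phi>2 x * cnj (\<phi>1 x))"
    by (intro integrable_L2_mult_cnj \<phi>)
  then have m\<phi>: "(\<lambda>x. \<phi>2 x * cnj (\<phi>1 x)) \<in> borel_measurable lebesgue"
    using borel_measurable_integrable by fastforce
  have 1: "integrable lebesgue ?\<phi>" using i\<phi> unfolding integral_window_space(1)[OF m\<phi>] .
  have 2: "integrable lebesgue ?\<psi>"
    using integrable_L2_mult_cnj[OF \<psi>] by (simp add: signal_space_def)
  have eq: "(1 / \<bar>fst z\<bar>) *\<^sub>R ?F z = ?\<phi> (fst z) * ?\<psi> (snd z)" for z
    by (simp add: simple_fun_def split_def mult_ac)
  show "integrable window_signal_space ?F"
    unfolding integral_window_signal_space(1)[OF Fm] eq by (rule lebesgue_integral_tensor(1)[OF 1 2])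
  show "L2_inner window_signal_space (simple_fun \<phi>1 \<psi>1) (simple_fun \<phi>2 \<psi>2)
      = L2_inner window_space \<phi>2 \<phi>1 * L2_inner signal_space \<psi>1 \<psi>2"
    unfolding L2_inner_def integral_window_signal_space(2)[OF Fm] eq lebesgue_integral_tensor(2)[OF 1 2]
      integral_window_space(2)[OF m\<phi>] by (simp add: signal_space_def)
qed

lemma simple_fun_L2:
  assumes "\<phi> \<in> L2 window_space" "\<psi> \<in> L2 signal_space"
  shows "simple_fun \<phi> \<psi> \<in> L2 window_signal_space"
proof -
  have "integrable window_signal_space (\<lambda>z. Re (simple_fun \<phi> \<psi> z * cnj (simple_fun \<phi> \<psi> z)))"
    using simple_fun_inner(1)[OF assms(1,1,2,2)] by (rule integrable_Re)
  then show ?thesis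
    using simple_fun_inner(3)[OF assms(1,1,2,2)]
    by (simp add: L2_def flip: complex_norm_square)
qed

section \<open>Inner products and norms in L2\<close>

lemma L2_scale: "f \<in> L2 M \<Longrightarrow> (\<lambda>x. c * f x) \<in> L2 M"
  by (auto simp: L2_def norm_mult power_mult_distrib intro: borel_measurable_times)

lemma L2_diff:
  assumes "f \<in> L2 M" "g \<in> L2 M"
  shows "(\<lambda>x. f x - g x) \<in> L2 M"
proof -
  have [measurable]: "f \<in> borel_measurable M" "g \<in> borel_measurable M"
    using assms by (auto simp: L2_def)
  have "integrable M (\<lambda>x. (cmod (f x - g x))\<^sup>2)"
  proof (rule Bochner_Integration.integrable_bound)
    show "integrable M (\<lambda>x. 2 * (cmod (f x))\<^sup>2 + 2 * (cmod (g x))\<^sup>2)"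
      using assms by (simp add: L2_def)
    have "(cmod (f x - g x))\<^sup>2 \<le> 2 * (cmod (f x))\<^sup>2 + 2 * (cmod (g x))\<^sup>2" for x
    proof -
      have "(cmod (f x - g x))\<^sup>2 \<le> (cmod (f x) + cmod (g x))\<^sup>2"
        by (intro power_mono norm_triangle_ineq4) simp
      then show ?thesis
        using sum_squares_bound[of "cmod (f x)" "cmod (g x)"] by (simp add: power2_sum)
    qed
    then show "AE x in M. norm ((cmod (f x - g x))\<^sup>2) \<le> norm (2 * (cmod (f x))\<^sup>2 + 2 * (cmod (g x))\<^sup>2)"
      by simp
  qed simp
  then show ?thesis by (simp add: L2_def)
qed

lemma L2_inner_scale_left: "L2_inner M (\<lambda>x. c * f x) g = c * L2_inner M f g"
  by (simp add: L2_inner_def mult.assoc)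

lemma L2_inner_diff_left:
  assumes "f \<in> L2 M" "g \<in> L2 M" "h \<in> L2 M"
  shows "L2_inner M (\<lambda>x. f x - g x) h = L2_inner M f h - L2_inner M g h"
  unfolding L2_inner_def
  by (simp add: left_diff_distrib integrable_L2_mult_cnj assms)

lemma L2_inner_commute: "L2_inner M g f = cnj (L2_inner M f g)"
  unfolding L2_inner_def Bochner_Integration.integral_cnj[symmetric] by (simp add: mult.commute)

lemma L2_inner_diff_right:
  assumes "f \<in> L2 M" "g \<in> L2 M" "h \<in> L2 M"
  shows "L2_inner M h (\<lambda>x. f x - g x) = L2_inner M h f - L2_inner M h g"
  using arg_cong[OF L2_inner_diff_left[OF assms], of cnj] by (simp flip: L2_inner_commute)

lemma L2_norm_square: "of_real ((L2_norm M f)\<^sup>2) = L2_inner M f f"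
proof -
  have "(\<integral>x. (cmod (f x))\<^sup>2 \<partial>M) \<ge> 0" by (rule Bochner_Integration.integral_nonneg) simp
  then have "complex_of_real ((L2_norm M f)\<^sup>2) = of_real (\<integral>x. (cmod (f x))\<^sup>2 \<partial>M)"
    by (simp add: L2_norm_def)
  also have "\<dots> = (\<integral>x. of_real ((cmod (f x))\<^sup>2) \<partial>M)"
    by (rule integral_complex_of_real[symmetric])
  finally show ?thesis by (simp only: L2_inner_def complex_norm_square)
qed

lemma L2_norm_diff_orthogonal:
  assumes "f \<in> L2 M" "g \<in> L2 M" and orth: "L2_inner M f g = 0"
  shows "(L2_norm M (\<lambda>x. f x - g x))\<^sup>2 = (L2_norm M f)\<^sup>2 + (L2_norm M g)\<^sup>2"
proof -
  have orth': "L2_inner M g f = 0" using orth L2_inner_commute[of M g f] by simp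
  have d: "(\<lambda>x. f x - g x) \<in> L2 M" by (intro L2_diff assms)
  have "complex_of_real ((L2_norm M (\<lambda>x. f x - g x))\<^sup>2)
      = L2_inner M f (\<lambda>x. f x - g x) - L2_inner M g (\<lambda>x. f x - g x)"
    unfolding L2_norm_square by (rule L2_inner_diff_left[OF assms(1,2) d])
  also have "L2_inner M f (\<lambda>x. f x - g x) = L2_inner M f f"
    by (simp add: L2_inner_diff_right[OF assms(1,2,1)] orth)
  also have "L2_inner M g (\<lambda>x. f x - g x) = - L2_inner M g g"
    by (simp add: L2_inner_diff_right[OF assms(1,2,2)] orth')
  finally have "complex_of_real ((L2_norm M (\<lambda>x. f x - g x))\<^sup>2)
      = of_real ((L2_norm M f)\<^sup>2 + (L2_norm M g)\<^sup>2)"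
    by (simp only: of_real_add L2_norm_square diff_minus_eq_add)
  then show ?thesis by (simp only: of_real_eq_iff)
qed

section \<open>The operator on simple functions\<close>

text \<open>On the line through \<open>(x, y)\<close> the chain rule contributes the factor
  \<open>x / y\<close>, whose numerator goes into the dilation operator on \<open>f\<close> and
  whose denominator goes into the multiplier on \<open>s\<close>. The minus sign comes from
  conjugating the \<i> inside the window factor.\<close>

lemma breve_T_simple_fun:
  assumes s: "locally_abs_continuous s" and f: "locally_abs_continuous f"
  shows "AE z in lebesgue. breve_T (simple_fun f s) z
    = simple_fun f (diff_op (\<lambda>_. \<i>) s) z
      - simple_fun (diff_op (\<lambda>\<omega>'. \<i> * of_real \<omega>') f) (mult_op (\<lambda>\<omega>. 1 / of_real \<omega>) s) z"
proof -
  have "AE x in lebesgue. x \<noteq> (0::real)"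
    by (rule AE_I'[of "{0}"]) (auto simp flip: negligible_iff_null_sets)
  from AE_lebesgue_fst_snd(2)[OF this]
    AE_lebesgue_fst_snd(1)[OF locally_abs_continuous_differentiable_ae[OF f]]
    AE_lebesgue_fst_snd(2)[OF locally_abs_continuous_differentiable_ae[OF s]]
  show ?thesis
  proof eventually_elim
    case (elim z)
    obtain x y where z: "z = (x, y)" by (cases z)
    define f' s' where "f' = vector_derivative f (at x)" and "s' = vector_derivative s (at y)"
    have y: "y \<noteq> 0" and f': "(f has_vector_derivative f') (at x)"
      and s': "(s has_vector_derivative s') (at y)" using elim by (auto simp: z f'_def s'_def)
    have "((\<lambda>t. x / y * t) has_vector_derivative x / y) (at y)"
      by (auto intro!: derivative_eq_intros)
    moreover have "(f has_vector_derivative f') (at (x / y * y))" using f' y by simp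
    ultimately have "(f \<circ> (\<lambda>t. x / y * t) has_vector_derivative (x / y) *\<^sub>R f') (at y)"
      by (rule vector_diff_chain_at)
    then have "((\<lambda>t. cnj (f (x / y * t)) * s t) has_vector_derivative
        (cnj (f (x / y * y)) * s' + cnj ((x / y) *\<^sub>R f') * s y)) (at y)"
      unfolding o_def by (intro has_vector_derivative_mult has_vector_derivative_cnj s')
    then have "vector_derivative (\<lambda>t. cnj (f (x / y * t)) * s t) (at y)
        = cnj (f x) * s' + cnj ((x / y) *\<^sub>R f') * s y"
      using y by (simp add: vector_derivative_at)
    then show ?case
      using y by (simp add: z breve_T_def simple_fun_def diff_op_def mult_op_def f'_def s'_def
          scaleR_conv_of_real algebra_simps)
  qed
qed

text \<open>Dilation preserves absolute continuity for every factor, so the line condition in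
  \<open>Dom_breve_T\<close> is obtained for all \<kappa>.\<close>

lemma locally_abs_continuous_simple_fun_line:
  assumes "locally_abs_continuous s" "locally_abs_continuous f"
  shows "locally_abs_continuous (\<lambda>t. simple_fun f s (\<kappa> * t, t))"
  unfolding simple_fun_def split_conv
  by (intro locally_abs_continuous_mult locally_abs_continuous_cnj locally_abs_continuous_scale assms)

theorem proposition13:
  fixes s f :: "real \<Rightarrow> complex"
  assumes "s \<in> Dom_S" and "f \<in> Dom_W"
    and "L2_norm window_space f = 1" and "L2_norm signal_space s = 1"
  shows "simple_fun f s \<in> Dom_breve_T \<and>
    op_mean window_signal_space breve_T (simple_fun f s) =
      op_mean signal_space (diff_op (\<lambda>_. \<i>)) s
      - op_mean window_space (diff_op (\<lambda>\<omega>'. \<i> * of_real \<omega>')) f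
        * op_mean signal_space (mult_op (\<lambda>\<omega>. 1 / of_real \<omega>)) s \<and>
    op_variance window_signal_space breve_T (simple_fun f s) =
      op_variance signal_space
        (\<lambda>g \<omega>. diff_op (\<lambda>_. \<i>) g \<omega>
          - op_mean window_space (diff_op (\<lambda>\<omega>'. \<i> * of_real \<omega>')) f
            * mult_op (\<lambda>\<omega>. 1 / of_real \<omega>) g \<omega>) s
      + op_variance window_space (diff_op (\<lambda>\<omega>'. \<i> * of_real \<omega>')) f
        * (L2_norm signal_space (mult_op (\<lambda>\<omega>. 1 / of_real \<omega>) s))\<^sup>2"
proof -
  let ?W = window_space and ?S = signal_space and ?WS = window_signal_space
  define A where "A = diff_op (\<lambda>_. \<i>) s"
  define B where "B = diff_op (\<lambda>\<omega>'. \<i> * of_real \<omega>') f"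
  define m where "m = mult_op (\<lambda>\<omega>. 1 / of_real \<omega>) s"
  define F where "F = simple_fun f s"
  have s: "s \<in> L2 ?S" "locally_abs_continuous s" "m \<in> L2 ?S"
    and f: "f \<in> L2 ?W" "locally_abs_continuous f"
    using assms(1,2) by (auto simp: Dom_S_def Dom_W_def m_def)
  have "diff_op (\<lambda>_. 1) s \<in> L2 ?S" using assms(1) by (simp add: Dom_S_def)
  then have A: "A \<in> L2 ?S"
    using L2_scale[of "diff_op (\<lambda>_. 1) s" ?S \<i>] by (simp add: A_def diff_op_def)
  have "diff_op (\<lambda>\<omega>'. of_real \<omega>') f \<in> L2 ?W" using assms(2) by (simp add: Dom_W_def)
  then have B: "B \<in> L2 ?W"
    using L2_scale[of "diff_op (\<lambda>\<omega>'. of_real \<omega>') f" ?W \<i>] by (simp add: B_def diff_op_def mult.assoc)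
  have ff: "L2_inner ?W f f = 1" and ss: "L2_inner ?S s s = 1"
    using assms(3,4) by (simp_all flip: L2_norm_square)
  define eB where "eB = L2_inner ?W B f"
  have eB_real: "cnj eB = eB"
    using dilation_mean_real[OF assms(2)] by (simp add: op_mean_def eB_def B_def)
  define eF where "eF = L2_inner ?S A s - eB * L2_inner ?S m s"

  have F: "F \<in> L2 ?WS" unfolding F_def by (intro simple_fun_L2 f s)
  \<comment> \<open>A representative of \<open>breve_T F\<close> that is a difference of two simple
    functions, hence visibly square integrable.\<close>
  define \<Phi> where "\<Phi> = (\<lambda>z. simple_fun f A z - simple_fun B m z)"
  have \<Phi>: "\<Phi> \<in> L2 ?WS" unfolding \<Phi>_def by (intro L2_diff simple_fun_L2 f s A B)
  have ae: "AE z in lebesgue. \<Phi> z = breve_T F z"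
    using breve_T_simple_fun[OF s(2) f(2)] unfolding \<Phi>_def F_def A_def B_def m_def
    by eventually_elim simp
  \<comment> \<open>On a null set \<open>breve_T F\<close> may take unspecified values; completeness
    of Lebesgue measure still makes it measurable, being almost everywhere equal to \<Phi>.\<close>
  have Tm: "breve_T F \<in> borel_measurable lebesgue"
    using \<Phi> by (intro borel_measurable_AE[OF _ ae]) (simp add: L2_def)
  have \<Phi>m: "\<Phi> \<in> borel_measurable lebesgue" and Fm: "F \<in> borel_measurable lebesgue"
    using \<Phi> F by (auto simp: L2_def)
  note aeW = AE_window_signal_space[OF ae]
  have "integrable ?WS (\<lambda>z. (cmod (breve_T F z))\<^sup>2)"
  proof (subst integrable_cong_AE)
    show "AE z in ?WS. (cmod (breve_T F z))\<^sup>2 = (cmod (\<Phi> z))\<^sup>2"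
      using aeW by eventually_elim simp
  qed (use \<Phi> Tm \<Phi>m in \<open>auto simp: L2_def\<close>)
  then have T: "breve_T F \<in> L2 ?WS" using Tm by (simp add: L2_def)
  then have dom: "F \<in> Dom_breve_T"
    using F locally_abs_continuous_simple_fun_line[OF s(2) f(2)] by (simp add: Dom_breve_T_def F_def)

  have "op_mean ?WS breve_T F = L2_inner ?WS \<Phi> F"
    unfolding op_mean_def L2_inner_def
  proof (rule integral_cong_AE)
    show "AE z in ?WS. breve_T F z * cnj (F z) = \<Phi> z * cnj (F z)"
      using aeW by eventually_elim simp
  qed (use integrable_L2_mult_cnj[OF T F] integrable_L2_mult_cnj[OF \<Phi> F] in
      \<open>blast intro: borel_measurable_integrable\<close>)+
  also have "\<dots> = L2_inner ?W f f * L2_inner ?S A s - L2_inner ?W f B * L2_inner ?S m s"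
    unfolding \<Phi>_def F_def
    by (simp add: L2_inner_diff_left simple_fun_L2 simple_fun_inner(2) f s A B)
  \<comment> \<open>The exchanged window arguments give the conjugate of the wanted mean; reality
    removes the conjugate.\<close>
  also have "L2_inner ?W f B = eB"
    using L2_inner_commute[of ?W f B] eB_real by (simp add: eB_def)
  finally have mean: "op_mean ?WS breve_T F = eF" by (simp add: ff eF_def)

  \<comment> \<open>The term \<open>eB\<close> times \<open>simple_fun f m\<close> is added and
    subtracted: the signal part \<open>X\<close> takes up one copy and the window part
    \<open>Y\<close> the other. The latter comes out of \<open>simple_fun\<close> conjugated, so the
    copies cancel because \<open>eB\<close> is real.\<close>
  define X where "X = (\<lambda>\<omega>. (A \<omega> - eB * m \<omega>) - eF * s \<omega>)"
  define Y where "Y = (\<lambda>\<omega>'. B \<omega>' - eB * f \<omega>')"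
  have X: "X \<in> L2 ?S" unfolding X_def by (intro L2_diff L2_scale A s)
  have Y: "Y \<in> L2 ?W" unfolding Y_def by (intro L2_diff L2_scale B f)
  \<comment> \<open>As \<open>f\<close> has norm 1, subtracting the mean removes exactly the
    component of \<open>B\<close> along \<open>f\<close>. This one vanishing factor makes the
    product of inner products below vanish.\<close>
  have "L2_inner ?W Y f = 0"
    unfolding Y_def
    by (simp add: L2_inner_diff_left L2_scale B f L2_inner_scale_left ff eB_def)
  then have orth: "L2_inner ?WS (simple_fun f X) (simple_fun Y m) = 0"
    by (simp add: simple_fun_inner(2) f X Y s)
  have split: "\<Phi> z - eF * F z = simple_fun f X z - simple_fun Y m z" for z
    by (simp add: \<Phi>_def F_def X_def Y_def simple_fun_def split_def eB_real algebra_simps)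
  have "L2_norm ?WS (\<lambda>z. breve_T F z - eF * F z) = L2_norm ?WS (\<lambda>z. \<Phi> z - eF * F z)"
    unfolding L2_norm_def
  proof (intro arg_cong[of _ _ sqrt] integral_cong_AE)
    show "AE z in ?WS. (cmod (breve_T F z - eF * F z))\<^sup>2 = (cmod (\<Phi> z - eF * F z))\<^sup>2"
      using aeW by eventually_elim simp
  qed (use Tm \<Phi>m Fm in auto)
  also have "\<dots> = L2_norm ?WS (\<lambda>z. simple_fun f X z - simple_fun Y m z)" by (simp add: split)
  finally have "op_variance ?WS breve_T F
      = (L2_norm ?WS (simple_fun f X))\<^sup>2 + (L2_norm ?WS (simple_fun Y m))\<^sup>2"
    by (simp add: op_variance_def mean L2_norm_diff_orthogonal simple_fun_L2 f s X Y orth)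
  moreover have norm: "(L2_norm ?WS (simple_fun \<phi> \<psi>))\<^sup>2 = (L2_norm ?W \<phi>)\<^sup>2 * (L2_norm ?S \<psi>)\<^sup>2"
    if "\<phi> \<in> L2 ?W" "\<psi> \<in> L2 ?S" for \<phi> \<psi>
  proof -
    have "complex_of_real ((L2_norm ?WS (simple_fun \<phi> \<psi>))\<^sup>2)
        = of_real ((L2_norm ?W \<phi>)\<^sup>2 * (L2_norm ?S \<psi>)\<^sup>2)"
      unfolding of_real_mult L2_norm_square by (rule simple_fun_inner(2)[OF that(1,1,2,2)])
    then show ?thesis by (simp only: of_real_eq_iff)
  qed
  ultimately have var: "op_variance ?WS breve_T F
      = (L2_norm ?S X)\<^sup>2 + (L2_norm ?W Y)\<^sup>2 * (L2_norm ?S m)\<^sup>2"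
    using f X Y s assms(3) by simp
  \<comment> \<open>The signal operator in the variance formula has the same mean \<open>eF\<close>
    as \<open>breve_T\<close>, so \<open>X\<close> is precisely its centred value at
    \<open>s\<close>.\<close>
  have "op_mean ?S (\<lambda>g \<omega>. diff_op (\<lambda>_. \<i>) g \<omega> - eB * mult_op (\<lambda>\<omega>. 1 / of_real \<omega>) g \<omega>) s = eF"
    unfolding op_mean_def eF_def A_def[symmetric] m_def[symmetric]
    by (simp add: L2_inner_diff_left L2_scale A s L2_inner_scale_left)
  then have "op_variance ?S (\<lambda>g \<omega>. diff_op (\<lambda>_. \<i>) g \<omega> - eB * mult_op (\<lambda>\<omega>. 1 / of_real \<omega>) g \<omega>) s
      = (L2_norm ?S X)\<^sup>2"
    by (simp add: op_variance_def X_def A_def m_def)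
  moreover have "op_mean ?W (diff_op (\<lambda>\<omega>'. \<i> * of_real \<omega>')) f = eB"
    by (simp add: op_mean_def eB_def B_def)
  moreover from this have "op_variance ?W (diff_op (\<lambda>\<omega>'. \<i> * of_real \<omega>')) f = (L2_norm ?W Y)\<^sup>2"
    by (simp add: op_variance_def Y_def B_def)
  ultimately show ?thesis
    using dom mean var
    by (simp add: F_def eF_def op_mean_def[of ?S] A_def m_def)
qed

end
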